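(* The thickness $\mathrm{t}(K)$ of a dynamical Cantor set is a continuous function of the maps $f_1,\dots,f_p$ defining $K$; that is, the function $(f_1,\dots,f_p)\mapsto \mathrm{t}(K)$, where $K$ is the limit set of the IFS $\{f_1,\dots,f_p\}$ on $S$, is continuous on the space of IFS's of $p$ maps on $S$.
   Context: $\mathbb{C}$ carries the Euclidean norm $|\cdot|$. Squares and disks are open. $A\Subset B$ means that $A$ is relatively compact in $B$. IFS. Fix a square $S\subset\mathbb{C}$ centered at $0$ (the initial square), an integer $p\ge1$, and a disk $S'$ of center $0$ whose diameter is larger than $\frac1r$ times the diameter (length of the diagonal) of $S$ for some $0<r<1$. An IFS $\{f_1,\dots,f_p\}$ on $S$ consists of univalent (injective holomorphic) contractions $f_i$ defined on $S$ with $f_i(S)\Subset S$, each of which extends to a univalent contraction on $S'$ with $f_i(S')\Subset S$. The space of such IFS's has the product topology of the compact-open topology on holomorphic maps from $S$ to $S$. The dynamical Cantor set (limit set) associated to the IFS is $K=\bigcap_{n\ge0}K_n$, where $K_0=S$ and $K_n=\bigcup_{1\le i\le p}f_i(K_{n-1})$ for $n\ge1$. For a finite sequence $I=(i_1,\dots,i_k)$ of digits in $\{1,\dots,p\}$, put $f_I=f_{i_k}\circ\dots\circ f_{i_1}$ (the identity if $k=0$). For $P=f_I(S)$, $\delta(P)$ is the diameter of the largest disk centered at $f_I(0)$ and included in $P$; in particular $\delta(S)$ is defined with center $0$. Write $S_i=f_i(S)$. Distorsion: $D_K=\sup_I\max_{(z,z')\in\overline S^2}\left|\frac{f_I'(z)}{f_I'(z')}\right|$,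 where the supremum is over all finite sequences $I$ of digits in $\{1,\dots,p\}$. It is finite. Further quantities: $\lambda_K^0=\min_{1\le i\le p}\frac{\delta(S_i)}{\delta(S)}$, $\lambda_K=\lambda_K^0/D_K^2$, $\rho(S)=2\sup_{z\in S}\mathrm{dist}(z,K)$, $\sigma_K^0=\rho(S)/\delta(S)$, $\sigma_K=D_K^2\sigma_K^0$. Thickness: $\mathrm{t}(K)=\dfrac{\lambda_K}{D_K^2\sqrt{\sigma_K}}=\dfrac{\lambda_K^0}{D_K^5\sqrt{\sigma_K^0}}$. *)

theory Defs
  imports "HOL-Complex_Analysis.Complex_Analysis"
begin

definition centered_square :: "complex set \<Rightarrow> bool" where
  "centered_square S \<longleftrightarrow>
     (\<exists>w. w \<noteq> 0 \<and> S = (\<lambda>z. w * z) ` {z. \<bar>Re z\<bar> < 1 \<and> \<bar>Im z\<bar> < 1})"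

definition rel_compact_in :: "complex set \<Rightarrow> complex set \<Rightarrow> bool"  (infix "\<Subset>" 50) where
  "A \<Subset> B \<longleftrightarrow> compact (closure A) \<and> closure A \<subseteq> B"

definition univalent_contraction :: "complex set \<Rightarrow> (complex \<Rightarrow> complex) \<Rightarrow> bool" where
  "univalent_contraction A f \<longleftrightarrow>
     f holomorphic_on A \<and> inj_on f A \<and> (\<exists>c<1. c-lipschitz_on A f)"

definition ifs_extension ::
    "complex set \<Rightarrow> complex set \<Rightarrow> (complex \<Rightarrow> complex) \<Rightarrow> (complex \<Rightarrow> complex) \<Rightarrow> bool" where
  "ifs_extension S S' f g \<longleftrightarrow>
     univalent_contraction S' g \<and> g ` S' \<Subset> S \<and> (\<forall>z\<in>S. g z = f z)"

definition ifs_map :: "complex set \<Rightarrow> complex set \<Rightarrow> (complex \<Rightarrow> complex) \<Rightarrow> bool" where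
  "ifs_map S S' f \<longleftrightarrow>
     univalent_contraction S f \<and> f ` S \<Subset> S \<and> (\<exists>g. ifs_extension S S' f g)"

text \<open>Maps between topological spaces are represented by extensional functions, so that two
  elements of the function space are equal iff they agree on the source space.\<close>

definition compact_open_topology ::
    "'a topology \<Rightarrow> 'b topology \<Rightarrow> ('a \<Rightarrow> 'b) topology" where
  "compact_open_topology X Y = topology_generated_by
     {{f \<in> extensional (topspace X). continuous_map X Y f \<and> f ` C \<subseteq> U} | C U.
        compactin X C \<and> openin Y U}"

definition holomorphic_self_maps :: "complex set \<Rightarrow> (complex \<Rightarrow> complex) topology" where
  "holomorphic_self_maps S =
     subtopology (compact_open_topology (top_of_set S) (top_of_set S)) {f. f holomorphic_on S}"

definition ifs_space ::
    "complex set \<Rightarrow> complex set \<Rightarrow> nat \<Rightarrow> (nat \<Rightarrow> complex \<Rightarrow> complex) topology" where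
  "ifs_space S S' p =
     subtopology (product_topology (\<lambda>i. holomorphic_self_maps S) {1..p})
       {f. \<forall>i\<in>{1..p}. ifs_map S S' (f i)}"

fun level_set ::
    "complex set \<Rightarrow> nat \<Rightarrow> (nat \<Rightarrow> complex \<Rightarrow> complex) \<Rightarrow> nat \<Rightarrow> complex set" where
  "level_set S p f 0 = S"
| "level_set S p f (Suc n) = (\<Union>i\<in>{1..p}. f i ` level_set S p f n)"

definition limit_set ::
    "complex set \<Rightarrow> nat \<Rightarrow> (nat \<Rightarrow> complex \<Rightarrow> complex) \<Rightarrow> complex set" where
  "limit_set S p f = (\<Inter>n. level_set S p f n)"

text \<open>For a word \<open>I = [i\<^sub>1, \<dots>, i\<^sub>k]\<close>, the map \<open>fold f I\<close> is
  \<open>f i\<^sub>k \<circ> \<dots> \<circ> f i\<^sub>1\<close>, i.e. the first digit of the word is applied first. The value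
  below is the inner diameter of the piece \<open>fold f I ` S\<close> about \<open>fold f I 0\<close>; the empty
  word gives that of \<open>S\<close> about \<open>0\<close>.\<close>

definition inner_diam ::
    "complex set \<Rightarrow> (nat \<Rightarrow> complex \<Rightarrow> complex) \<Rightarrow> nat list \<Rightarrow> real" where
  "inner_diam S f I =
     Sup {diameter (ball (fold f I 0) t) | t. 0 < t \<and> ball (fold f I 0) t \<subseteq> fold f I ` S}"

text \<open>The distorsion involves derivatives on the boundary of \<open>S\<close>, where the maps are
  understood through their extensions to \<open>S'\<close>. These are unique on \<open>S'\<close> by analytic
  continuation, so the choice below does not matter. The inner supremum is over a compact set and
  hence a maximum.\<close>

definition extend_ifs ::
    "complex set \<Rightarrow> complex set \<Rightarrow> (nat \<Rightarrow> complex \<Rightarrow> complex) \<Rightarrow> nat \<Rightarrow> complex \<Rightarrow> complex" where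
  "extend_ifs S S' f i = (SOME g. ifs_extension S S' (f i) g)"

definition distorsion ::
    "complex set \<Rightarrow> complex set \<Rightarrow> nat \<Rightarrow> (nat \<Rightarrow> complex \<Rightarrow> complex) \<Rightarrow> real" where
  "distorsion S S' p f =
     (SUP I\<in>lists {1..p}. SUP (z, z')\<in>closure S \<times> closure S.
        cmod (deriv (fold (extend_ifs S S' f) I) z / deriv (fold (extend_ifs S S' f) I) z'))"

definition lambda0 ::
    "complex set \<Rightarrow> nat \<Rightarrow> (nat \<Rightarrow> complex \<Rightarrow> complex) \<Rightarrow> real" where
  "lambda0 S p f = Min ((\<lambda>i. inner_diam S f [i] / inner_diam S f []) ` {1..p})"

definition lambda ::
    "complex set \<Rightarrow> complex set \<Rightarrow> nat \<Rightarrow> (nat \<Rightarrow> complex \<Rightarrow> complex) \<Rightarrow> real" where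
  "lambda S S' p f = lambda0 S p f / (distorsion S S' p f)\<^sup>2"

definition rho ::
    "complex set \<Rightarrow> nat \<Rightarrow> (nat \<Rightarrow> complex \<Rightarrow> complex) \<Rightarrow> real" where
  "rho S p f = 2 * (SUP z\<in>S. infdist z (limit_set S p f))"

definition sigma0 ::
    "complex set \<Rightarrow> nat \<Rightarrow> (nat \<Rightarrow> complex \<Rightarrow> complex) \<Rightarrow> real" where
  "sigma0 S p f = rho S p f / inner_diam S f []"

definition sigma ::
    "complex set \<Rightarrow> complex set \<Rightarrow> nat \<Rightarrow> (nat \<Rightarrow> complex \<Rightarrow> complex) \<Rightarrow> real" where
  "sigma S S' p f = (distorsion S S' p f)\<^sup>2 * sigma0 S p f"

definition thickness ::
    "complex set \<Rightarrow> complex set \<Rightarrow> nat \<Rightarrow> (nat \<Rightarrow> complex \<Rightarrow> complex) \<Rightarrow> real" where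
  "thickness S S' p f =
     lambda S S' p f / ((distorsion S S' p f)\<^sup>2 * sqrt (sigma S S' p f))"

end

theory Submission
  imports Defs
begin

text \<open>
  The evaluation maps \<open>f \<mapsto> f i z\<close> are continuous on the space of IFS's, and countably many of them
  suffice: if \<open>\<zeta>\<close> is a sequence in \<open>S - {0}\<close> tending to \<open>0\<close>, then convergence of IFS's at the
  points \<open>\<zeta> j\<close> to an IFS already forces uniform convergence of the extensions on compact subsets of \<open>S'\<close>. This is Vitali's theorem
  (\<open>vitali_uniform_limit\<close>): the extensions are uniformly bounded because they map \<open>S'\<close> into \<open>S\<close>,
  so Montel's theorem and the identity theorem apply. Hence it suffices to show that thickness
  converges along sequences of IFS's whose extensions converge locally uniformly on \<open>S'\<close>
  (\<open>continuous_map_real_if_sequential\<close>, \<open>tendsto_thickness\<close>). By Cauchy's estimates the derivatives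
  then converge uniformly on the closed square, and for all late terms of the sequence the
  extensions contract the closed square with a common constant \<open>c < 1\<close>. The three ingredients of
  the thickness are treated separately.

  \<^item> The inner diameter of \<open>f\<^sub>i(S)\<close> is twice the distance of \<open>f\<^sub>i(0)\<close> to the image of the frontier
    of \<open>S\<close>, and this depends continuously on the extension of \<open>f\<^sub>i\<close>.

  \<^item> If two IFS's differ by at most \<open>e\<close> on \<open>S\<close> and one of them contracts by \<open>c\<close>, then their level
    sets, and hence their limit sets, have Hausdorff distance at most \<open>e / (1 - c)\<close>; so \<open>\<rho>\<close> is
    continuous. It is positive since the limit set is contained in a compact subset of \<open>S\<close>.

  \<^item> For the distorsion, the logarithm of \<open>\<bar>f\<^sub>I'(z) / f\<^sub>I'(w)\<bar>\<close> is a sum over the letters of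
    the word \<open>I\<close>. When the IFS is perturbed, the \<open>j\<close>-th term changes by at most some \<open>a\<close> that
    tends to \<open>0\<close> with the size of the perturbation, but also by at most \<open>b c\<^sup>j\<close>, since the
    orbits of \<open>z\<close> and \<open>w\<close> under either IFS have come within \<open>c\<^sup>j\<close> times the diameter of \<open>S\<close>. The geometric mean
    \<open>sqrt (a b) (sqrt c)\<^sup>j\<close> of the two bounds is summable, so the total change is of order
    \<open>sqrt a\<close>, uniformly in the word and in the two points (\<open>log_distorsion_perturb\<close>).

  Finally \<open>D\<^sub>K \<ge> 1\<close> and \<open>\<rho>(S) > 0\<close>, so no denominator in the thickness vanishes.
\<close>

section \<open>Sequences of holomorphic functions\<close>

text \<open>
  Vitali's theorem: a subsequence staying away from \<open>f\<close> on \<open>K\<close> would have, by Montel, a further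
  subsequence with a holomorphic limit, which agrees with \<open>f\<close> on \<open>Z\<close> and hence everywhere.
\<close>
lemma vitali_uniform_limit:
  fixes F :: "nat \<Rightarrow> complex \<Rightarrow> complex"
  assumes A: "open A" "connected A"
    and holF: "\<And>n. F n holomorphic_on A"
    and bound: "\<And>n z. z \<in> A \<Longrightarrow> cmod (F n z) \<le> B"
    and holf: "f holomorphic_on A"
    and Z: "Z \<subseteq> A" "\<xi> \<in> A" "\<xi> islimpt Z"
    and lim: "\<And>z. z \<in> Z \<Longrightarrow> (\<lambda>n. F n z) \<longlonglongrightarrow> f z"
    and K: "compact K" "K \<subseteq> A"
  shows "uniform_limit K F f sequentially"
proof (rule ccontr)
  assume "\<not> uniform_limit K F f sequentially"
  then obtain e where e: "e > 0" 
    and "\<not> (\<forall>\<^sub>F n in sequentially. \<forall>x\<in>K. dist (F n x) (f x) < e)"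
    by (auto simp: uniform_limit_iff)
  then have "infinite {n. \<not> (\<forall>x\<in>K. dist (F n x) (f x) < e)}"
    by (simp add: cofinite_eq_sequentially [symmetric] eventually_cofinite)
  then obtain s :: "nat \<Rightarrow> nat" where s: "strict_mono s"
    and far: "\<And>k. \<not> (\<forall>x\<in>K. dist (F (s k) x) (f x) < e)"
    by (auto dest: infinite_enumerate)
  obtain g r where g: "g holomorphic_on A" and r: "strict_mono (r :: nat \<Rightarrow> nat)"
    and ptw: "\<And>x. x \<in> A \<Longrightarrow> (\<lambda>n. (F \<circ> s) (r n) x) \<longlonglongrightarrow> g x"
    and unif: "\<And>K. \<lbrakk>compact K; K \<subseteq> A\<rbrakk> \<Longrightarrow> uniform_limit K ((F \<circ> s) \<circ> r) g sequentially"
  proof (rule Montel [OF \<open>open A\<close>, of "range F" "F \<circ> s"])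
    show "h holomorphic_on A" if "h \<in> range F" for h
      using that holF by auto
    show "\<exists>B. \<forall>h\<in>range F. \<forall>z\<in>C. cmod (h z) \<le> B" if "C \<subseteq> A" for C
      using that bound by blast
  qed auto
  have "f w - g w = 0" if "w \<in> A" for w
  proof (rule analytic_continuation [of "\<lambda>w. f w - g w" A Z \<xi>])
    fix z assume z: "z \<in> Z"
    have "((\<lambda>n. F n z) \<circ> (s \<circ> r)) \<longlonglongrightarrow> f z"
      by (rule LIMSEQ_subseq_LIMSEQ [OF lim [OF z] strict_mono_o [OF s r]])
    moreover have "((\<lambda>n. F n z) \<circ> (s \<circ> r)) \<longlonglongrightarrow> g z"
      using ptw [of z] z Z by (auto simp: o_def)
    ultimately show "f z - g z = 0"
      using LIMSEQ_unique by fastforce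
  qed (use assms g that in \<open>auto intro: holomorphic_intros\<close>)
  then have "\<forall>x\<in>K. g x = f x"
    using K by auto
  moreover have "\<forall>\<^sub>F n in sequentially. \<forall>x\<in>K. dist (F (s (r n)) x) (g x) < e"
    using unif [OF K] e by (auto simp: uniform_limit_iff)
  ultimately have "\<forall>\<^sub>F n in sequentially. \<forall>x\<in>K. dist (F (s (r n)) x) (f x) < e"
    by simp
  then show False
    using far by simp
qed

lemma compact_neighbourhood_in_open:
  fixes Q :: "complex set"
  assumes "compact Q" "open A" "Q \<subseteq> A"
  obtains d K where "d > 0" "compact K" "K \<subseteq> A" "\<And>z. z \<in> Q \<Longrightarrow> cball z d \<subseteq> K"
proof -
  obtain e where e: "e > 0" "\<And>x. x \<in> Q \<Longrightarrow> ball x e \<subseteq> A"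
    using Heine_Borel_lemma [OF \<open>compact Q\<close>, of "{A}"] assms by auto
  show ?thesis
  proof
    show "e / 2 > 0" using e by simp
    show "compact {x + y |x y. x \<in> Q \<and> y \<in> cball 0 (e/2)}"
      by (intro compact_sums \<open>compact Q\<close> compact_cball)
    show "{x + y |x y. x \<in> Q \<and> y \<in> cball 0 (e/2)} \<subseteq> A"
    proof clarify
      fix x y :: complex assume "x \<in> Q" "y \<in> cball 0 (e/2)"
      then have "x + y \<in> ball x e" using e by (simp add: dist_norm)
      then show "x + y \<in> A" using e \<open>x \<in> Q\<close> by blast
    qed
    fix z assume "z \<in> Q"
    show "cball z (e/2) \<subseteq> {x + y |x y. x \<in> Q \<and> y \<in> cball 0 (e/2)}"
    proof
      fix w assume "w \<in> cball z (e/2)"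
      then have "w = z + (w - z) \<and> z \<in> Q \<and> w - z \<in> cball 0 (e/2)"
        using \<open>z \<in> Q\<close> by (auto simp: dist_norm norm_minus_commute)
      then show "w \<in> {x + y |x y. x \<in> Q \<and> y \<in> cball 0 (e/2)}" by blast
    qed
  qed
qed

lemma uniform_limit_deriv:
  fixes F :: "nat \<Rightarrow> complex \<Rightarrow> complex"
  assumes "open A" and holF: "\<And>n. F n holomorphic_on A" and holf: "f holomorphic_on A"
    and unif: "\<And>K. compact K \<Longrightarrow> K \<subseteq> A \<Longrightarrow> uniform_limit K F f sequentially"
    and "compact Q" "Q \<subseteq> A"
  shows "uniform_limit Q (\<lambda>n. deriv (F n)) (deriv f) sequentially"
proof -
  obtain d K where d: "d > 0" and K: "compact K" "K \<subseteq> A" and dK: "\<And>z. z \<in> Q \<Longrightarrow> cball z d \<subseteq> K"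
    using compact_neighbourhood_in_open [OF \<open>compact Q\<close> \<open>open A\<close> \<open>Q \<subseteq> A\<close>] by metis
  show ?thesis
    unfolding uniform_limit_iff
  proof (intro allI impI)
    fix e :: real assume e: "e > 0"
    then have "\<forall>\<^sub>F n in sequentially. \<forall>x\<in>K. dist (F n x) (f x) < e / 2 * d"
      using uniform_limitD [OF unif [OF K], of "e / 2 * d"] d by simp
    then show "\<forall>\<^sub>F n in sequentially. \<forall>x\<in>Q. dist (deriv (F n) x) (deriv f x) < e"
    proof eventually_elim
      case (elim n)
      show ?case
      proof
        fix z assume z: "z \<in> Q"
        have sub: "cball z d \<subseteq> A" using dK [OF z] K by blast
        have hol: "(\<lambda>w. F n w - f w) holomorphic_on A"
          by (intro holomorphic_intros holF holf)
        have "norm ((deriv ^^ 1) (\<lambda>w. F n w - f w) z) \<le> fact 1 * (e/2 * d) / d ^ 1"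
        proof (rule Cauchy_inequality)
          show "(\<lambda>w. F n w - f w) holomorphic_on ball z d"
            using hol sub by (meson ball_subset_cball holomorphic_on_subset order_trans)
          show "continuous_on (cball z d) (\<lambda>w. F n w - f w)"
            using hol sub by (meson holomorphic_on_imp_continuous_on holomorphic_on_subset)
          fix x assume "cmod (z - x) = d"
          then have "x \<in> K" using dK [OF z] by (auto simp: dist_norm)
          then show "cmod (F n x - f x) \<le> e/2 * d"
            using elim by (force simp: dist_norm)
        qed (use d in auto)
        moreover have "deriv (\<lambda>w. F n w - f w) z = deriv (F n) z - deriv f z"
          using z \<open>Q \<subseteq> A\<close> \<open>open A\<close> holF [of n] holf
          by (intro deriv_diff) (meson holomorphic_on_imp_differentiable_at subsetD)+
        ultimately show "dist (deriv (F n) z) (deriv f z) < e"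
          using d e by (simp add: dist_norm)
      qed
    qed
  qed
qed

lemma bounded_second_derivative:
  assumes "open A" "f holomorphic_on A" "\<And>z. z \<in> A \<Longrightarrow> cmod (f z) \<le> B"
    and "d > 0" "cball z d \<subseteq> A"
  shows "cmod (deriv (deriv f) z) \<le> 2 * B / d\<^sup>2"
proof -
  have "norm ((deriv ^^ 2) f z) \<le> fact 2 * B / d ^ 2"
  proof (rule Cauchy_inequality)
    show "f holomorphic_on ball z d"
      using assms by (meson ball_subset_cball holomorphic_on_subset order_trans)
    show "continuous_on (cball z d) f"
      using assms by (meson holomorphic_on_imp_continuous_on holomorphic_on_subset)
    fix x assume "cmod (z - x) = d"
    then show "cmod (f x) \<le> B"
      using assms by (auto simp: dist_norm)
  qed (use assms in auto)
  then show ?thesis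
    by (simp add: eval_nat_numeral)
qed

section \<open>Inner diameters\<close>

lemma Sup_diameter_balls:
  fixes U :: "complex set"
  assumes "open U" "bounded U" "x \<in> U"
  shows "Sup {diameter (ball x t) |t. 0 < t \<and> ball x t \<subseteq> U} = 2 * infdist x (frontier U)"
    and "0 < infdist x (frontier U)"
proof -
  have ne: "frontier U \<noteq> {}"
    using assms frontier_not_empty not_bounded_UNIV by blast
  have "x \<notin> frontier U"
    using assms by (simp add: frontier_def interior_open)
  then show pos: "0 < infdist x (frontier U)"
    using ne by (intro infdist_pos_not_in_closed) auto
  show "Sup {diameter (ball x t) |t. 0 < t \<and> ball x t \<subseteq> U} = 2 * infdist x (frontier U)"
  proof (rule cSup_eq_maximum)
    have "ball x (infdist x (frontier U)) \<inter> frontier U = {}"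
      using infdist_le [of _ "frontier U" x] by force
    then have "ball x (infdist x (frontier U)) \<subseteq> U"
      using connected_Int_frontier [of "ball x (infdist x (frontier U))" U] assms pos
      by (metis Diff_eq_empty_iff IntI centre_in_ball connected_ball empty_iff)
    then show "2 * infdist x (frontier U) \<in> {diameter (ball x t) |t. 0 < t \<and> ball x t \<subseteq> U}"
      using pos by (auto intro!: exI [of _ "infdist x (frontier U)"])
    fix y assume "y \<in> {diameter (ball x t) |t. 0 < t \<and> ball x t \<subseteq> U}"
    then obtain t where t: "0 < t" "ball x t \<subseteq> U" "y = diameter (ball x t)" by blast
    have "t \<le> infdist x (frontier U)"
      unfolding infdist_notempty [OF ne]
    proof (rule cINF_greatest [OF ne])
      fix a assume "a \<in> frontier U"
      then have "a \<notin> ball x t"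
        using t assms by (auto simp: frontier_def interior_open)
      then show "t \<le> dist x a" by simp
    qed
    then show "y \<le> 2 * infdist x (frontier U)"
      using t by simp
  qed
qed

text \<open>As \<open>g\<close> is injective and open, and the closure of \<open>S\<close> is compact, \<open>g\<close> carries the closure and the
  interior of \<open>S\<close> to those of its image.\<close>
lemma frontier_univalent_image:
  assumes "open A" "g holomorphic_on A" "inj_on g A" "open S" "bounded S" "closure S \<subseteq> A"
  shows "frontier (g ` S) = g ` frontier S"
proof -
  have sub: "S \<subseteq> A" using assms closure_subset by blast
  have "open (g ` S)"
    using assms sub by (meson holomorphic_on_subset inj_on_subset open_mapping_thm3)
  have cont: "continuous_on (closure S) g"
    using assms by (meson holomorphic_on_imp_continuous_on holomorphic_on_subset)
  have "compact (g ` closure S)"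
    using assms by (intro compact_continuous_image cont) auto
  then have "closure (g ` S) \<subseteq> g ` closure S"
    by (intro closure_minimal image_mono closure_subset compact_imp_closed)
  moreover have "g ` closure S \<subseteq> closure (g ` S)"
    using cont by (intro image_closure_subset closure_subset) auto
  ultimately have "closure (g ` S) = g ` closure S" by auto
  moreover have "g ` closure S - g ` S = g ` (closure S - S)"
    using assms closure_subset [of S] inj_on_image_set_diff [of g "closure S" "closure S" S]
    by (metis Diff_subset inj_on_subset)
  ultimately show ?thesis
    using \<open>open (g ` S)\<close> \<open>open S\<close> by (simp add: frontier_def interior_open)
qed

lemma infdist_image_perturb:
  fixes g h :: "'a \<Rightarrow> 'b::metric_space"
  assumes "F \<noteq> {}" "dist (g x) (h x) \<le> e" "\<And>y. y \<in> F \<Longrightarrow> dist (g y) (h y) \<le> e"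
  shows "infdist (g x) (g ` F) \<le> infdist (h x) (h ` F) + 2 * e"
proof -
  have "infdist (g x) (g ` F) - 2 * e \<le> (INF a\<in>h ` F. dist (h x) a)"
  proof (rule cINF_greatest)
    fix a assume "a \<in> h ` F"
    then obtain y where y: "y \<in> F" "a = h y" by blast
    have "infdist (g x) (g ` F) \<le> dist (g x) (g y)"
      using y by (intro infdist_le) auto
    also have "\<dots> \<le> dist (g x) (h x) + dist (h x) (h y) + dist (g y) (h y)"
      by metric
    finally show "infdist (g x) (g ` F) - 2 * e \<le> dist (h x) a"
      using assms y by force
  qed (use assms in auto)
  then show ?thesis
    using assms by (simp add: infdist_notempty)
qed

lemma tendsto_infdist_image:
  fixes g :: "'a \<Rightarrow> 'b::metric_space"
  assumes "uniform_limit C G g sequentially" "x \<in> C" "F \<subseteq> C" "F \<noteq> {}"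
  shows "(\<lambda>n. infdist (G n x) (G n ` F)) \<longlonglongrightarrow> infdist (g x) (g ` F)"
proof (rule tendstoI)
  fix e :: real assume "e > 0"
  then have "\<forall>\<^sub>F n in sequentially. \<forall>y\<in>C. dist (G n y) (g y) < e / 3"
    using uniform_limitD [OF assms(1), of "e / 3"] by simp
  then show "\<forall>\<^sub>F n in sequentially. dist (infdist (G n x) (G n ` F)) (infdist (g x) (g ` F)) < e"
  proof eventually_elim
    case (elim n)
    then have near: "dist (G n y) (g y) \<le> e / 3" "dist (g y) (G n y) \<le> e / 3" if "y \<in> C" for y
      using that by (auto simp: dist_commute less_imp_le)
    then have "infdist (G n x) (G n ` F) \<le> infdist (g x) (g ` F) + 2 * (e / 3)"
      using infdist_image_perturb [of F "G n" x g "e / 3"] assms by (simp add: subset_iff)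
    moreover have "infdist (g x) (g ` F) \<le> infdist (G n x) (G n ` F) + 2 * (e / 3)"
      using infdist_image_perturb [of F g x "G n" "e / 3"] assms near by (simp add: subset_iff)
    ultimately show ?case
      using \<open>e > 0\<close> by (simp add: dist_real_def abs_if)
  qed
qed

lemma tendsto_Min_image:
  fixes X :: "nat \<Rightarrow> 'i \<Rightarrow> real"
  assumes "finite I" "I \<noteq> {}" "\<And>i. i \<in> I \<Longrightarrow> (\<lambda>n. X n i) \<longlonglongrightarrow> x i"
  shows "(\<lambda>n. Min (X n ` I)) \<longlonglongrightarrow> Min (x ` I)"
  using assms
proof (induction I rule: finite_ne_induct)
  case (insert i I)
  have "(\<lambda>n. min (X n i) (Min (X n ` I))) \<longlonglongrightarrow> min (x i) (Min (x ` I))"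
    by (rule tendsto_min) (use insert in simp_all)
  with insert.hyps show ?case by simp
qed simp

section \<open>Limit sets\<close>

lemma level_set_subset:
  assumes "\<And>i. i \<in> {1..p} \<Longrightarrow> f i ` S \<subseteq> S"
  shows "level_set S p f n \<subseteq> S"
proof (induction n)
  case (Suc n)
  show ?case
  proof
    fix x assume "x \<in> level_set S p f (Suc n)"
    then obtain i y where "i \<in> {1..p}" "y \<in> level_set S p f n" "x = f i y" by auto
    then show "x \<in> S" using Suc assms by blast
  qed
qed simp

lemma limit_set_subset: "limit_set S p f \<subseteq> S"
  unfolding limit_set_def using level_set.simps(1) [of S p f] by blast

lemma limit_set_invariant:
  assumes "i \<in> {1..p}" "f i ` S \<subseteq> S" "x \<in> limit_set S p f"
  shows "f i x \<in> limit_set S p f"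
  unfolding limit_set_def
proof
  fix n
  have x: "x \<in> level_set S p f m" for m
    using assms by (auto simp: limit_set_def)
  show "f i x \<in> level_set S p f n"
  proof (cases n)
    case 0
    then show ?thesis using x [of 0] assms by auto
  next
    case (Suc m)
    then show ?thesis using x [of m] assms by auto
  qed
qed

text \<open>The limit set contains the fixed point of \<open>f i\<close>.\<close>
lemma limit_set_nonempty:
  assumes "i \<in> {1..p}" "f i ` S \<Subset> S" "c < 1" "c-lipschitz_on S (f i)" "S \<noteq> {}"
  shows "limit_set S p f \<noteq> {}"
proof -
  have sub: "closure (f i ` S) \<subseteq> S"
    using assms by (auto simp: rel_compact_in_def)
  have "\<exists>!x\<in>closure (f i ` S). f i x = x"
  proof (rule Banach_fix)
    show "complete (closure (f i ` S))"
      by (simp add: complete_eq_closed)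
    show "f i ` closure (f i ` S) \<subseteq> closure (f i ` S)"
      using sub closure_subset by blast
    show "0 \<le> c" "c < 1"
      using assms lipschitz_on_nonneg by blast+
    fix x y assume "x \<in> closure (f i ` S)" "y \<in> closure (f i ` S)"
    then show "dist (f i x) (f i y) \<le> c * dist x y"
      using sub assms(4) by (meson lipschitz_onD subsetD)
  qed (use assms in auto)
  then obtain x where x: "x \<in> S" "f i x = x" using sub by blast
  have "x \<in> level_set S p f n" for n
  proof (induction n)
    case (Suc n)
    then have "f i x \<in> level_set S p f (Suc n)"
      using assms(1) by (simp only: level_set.simps) blast
    then show ?case using x by simp
  qed (use x in auto)
  then show ?thesis unfolding limit_set_def by blast
qed

text \<open>Every piece of level \<open>n\<close> contains a point of the limit set and has diameter at most \<open>c ^ n\<close>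
  times that of \<open>S\<close>.\<close>
lemma level_set_near_limit_set:
  assumes f: "\<And>i. i \<in> {1..p} \<Longrightarrow> f i ` S \<subseteq> S" "\<And>i. i \<in> {1..p} \<Longrightarrow> c-lipschitz_on S (f i)"
    and "bounded S" "limit_set S p f \<noteq> {}" "0 \<le> c" "y \<in> level_set S p f n"
  shows "\<exists>k\<in>limit_set S p f. dist y k \<le> c ^ n * diameter S"
  using \<open>y \<in> level_set S p f n\<close>
proof (induction n arbitrary: y)
  case 0
  obtain k where k: "k \<in> limit_set S p f" using assms by blast
  then have "dist y k \<le> diameter S"
    using 0 assms limit_set_subset by (metis diameter_bounded_bound level_set.simps(1) subsetD)
  with k show ?case by auto
next
  case (Suc n)
  then obtain i y' where i: "i \<in> {1..p}" "y' \<in> level_set S p f n" "y = f i y'" by auto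
  obtain k where k: "k \<in> limit_set S p f" "dist y' k \<le> c ^ n * diameter S"
    using Suc.IH [OF i(2)] by blast
  have "dist y (f i k) \<le> c * dist y' k"
    unfolding i
  proof (rule lipschitz_onD [OF f(2) [OF i(1)]])
    show "y' \<in> S"
      using subsetD [OF level_set_subset [of p f S n, OF f(1)] i(2)] by simp
    show "k \<in> S"
      using k limit_set_subset by blast
  qed
  also have "\<dots> \<le> c * (c ^ n * diameter S)"
    using k assms by (intro mult_left_mono) auto
  finally show ?case
    using limit_set_invariant [of i p f S k, OF i(1) f(1) [OF i(1)] k(1)]
    by (auto simp: mult.assoc)
qed

text \<open>The bound satisfies \<open>e + c * (e / (1 - c)) = e / (1 - c)\<close>, so it is preserved from one level to
  the next. Only one of the two families has to be contracting.\<close>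
lemma level_set_perturb:
  assumes f: "\<And>i. i \<in> {1..p} \<Longrightarrow> f i ` S \<subseteq> S" and h: "\<And>i. i \<in> {1..p} \<Longrightarrow> h i ` S \<subseteq> S"
    and c: "\<And>i. i \<in> {1..p} \<Longrightarrow> c-lipschitz_on S (f i)" "0 \<le> c" "c < 1"
    and e: "\<And>i z. i \<in> {1..p} \<Longrightarrow> z \<in> S \<Longrightarrow> dist (f i z) (h i z) \<le> e" "0 \<le> e"
    and "x \<in> level_set S p h n"
  shows "\<exists>y\<in>level_set S p f n. dist x y \<le> e / (1 - c)"
  using \<open>x \<in> level_set S p h n\<close>
proof (induction n arbitrary: x)
  case 0
  moreover have "0 \<le> e / (1 - c)" using c e by simp
  ultimately show ?case by (auto intro!: bexI [of _ x])
next
  case (Suc n)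
  then obtain i x' where i: "i \<in> {1..p}" "x' \<in> level_set S p h n" "x = h i x'" by auto
  then obtain y' where y': "y' \<in> level_set S p f n" "dist x' y' \<le> e / (1 - c)"
    using Suc.IH [OF i(2)] by blast
  have S: "x' \<in> S" "y' \<in> S"
    using subsetD [OF level_set_subset [of p f S n, OF f] y'(1)]
      subsetD [OF level_set_subset [of p h S n, OF h] i(2)] by simp_all
  have "dist x (f i y') \<le> dist (f i x') (h i x') + dist (f i x') (f i y')"
    unfolding i(3) by metric
  also have "\<dots> \<le> e + c * dist x' y'"
    by (intro add_mono e(1) [OF i(1) S(1)] lipschitz_onD [OF c(1) [OF i(1)] S])
  also have "\<dots> \<le> e + c * (e / (1 - c))"
    using y' c by (intro add_left_mono mult_left_mono) auto
  also have "\<dots> = e / (1 - c)"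
    using c by (simp add: field_simps)
  finally have "dist x (f i y') \<le> e / (1 - c)" .
  moreover have "f i y' \<in> level_set S p f (Suc n)"
    using i y' by auto
  ultimately show ?case by blast
qed

lemma infdist_limit_set_perturb:
  assumes f: "\<And>i. i \<in> {1..p} \<Longrightarrow> f i ` S \<subseteq> S" "\<And>i. i \<in> {1..p} \<Longrightarrow> c-lipschitz_on S (f i)"
    and "bounded S" "limit_set S p f \<noteq> {}" "limit_set S p h \<noteq> {}" "0 \<le> c" "c < 1"
    and near: "\<And>n x. x \<in> level_set S p h n \<Longrightarrow> \<exists>y\<in>level_set S p f n. dist x y \<le> d"
  shows "infdist z (limit_set S p f) \<le> infdist z (limit_set S p h) + d"
proof -
  have *: "infdist x (limit_set S p f) \<le> d" if x: "x \<in> limit_set S p h" for x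
  proof (rule LIMSEQ_le_const)
    have "(\<lambda>n. d + c ^ n * diameter S) \<longlonglongrightarrow> d + 0 * diameter S"
      using assms by (intro tendsto_intros LIMSEQ_power_zero) auto
    then show "(\<lambda>n. d + c ^ n * diameter S) \<longlonglongrightarrow> d" by simp
    show "\<exists>N. \<forall>n\<ge>N. infdist x (limit_set S p f) \<le> d + c ^ n * diameter S"
    proof (intro exI allI impI)
      fix n
      have "x \<in> level_set S p h n" using x by (auto simp: limit_set_def)
      then obtain y where y: "y \<in> level_set S p f n" "dist x y \<le> d" using near by metis
      then obtain k where k: "k \<in> limit_set S p f" "dist y k \<le> c ^ n * diameter S"
        using level_set_near_limit_set [of p f S c, OF f assms(3,4,6)] by metis
      have "infdist x (limit_set S p f) \<le> dist x k"
        using k by (intro infdist_le)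
      also have "\<dots> \<le> dist x y + dist y k" by metric
      finally show "infdist x (limit_set S p f) \<le> d + c ^ n * diameter S"
        using y k by linarith
    qed
  qed
  have "infdist z (limit_set S p f) - d \<le> (INF x\<in>limit_set S p h. dist z x)"
  proof (rule cINF_greatest)
    fix x assume "x \<in> limit_set S p h"
    then show "infdist z (limit_set S p f) - d \<le> dist z x"
      using * [of x] infdist_triangle [of z "limit_set S p f" x] by linarith
  qed (use assms in auto)
  then show ?thesis
    using assms by (simp add: infdist_notempty)
qed

lemma bdd_above_infdist:
  fixes K S :: "complex set"
  assumes "bounded S" "K \<subseteq> S" "K \<noteq> {}"
  shows "bdd_above ((\<lambda>z. infdist z K) ` S)"
proof -
  obtain k where k: "k \<in> K" using assms by blast
  show ?thesis
  proof (rule bdd_aboveI2)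
    fix z assume "z \<in> S"
    then show "infdist z K \<le> diameter S"
      using k assms by (meson diameter_bounded_bound infdist_le order_trans subsetD)
  qed
qed

lemma rho_perturb:
  assumes "bounded S" "S \<noteq> {}" "limit_set S p h \<noteq> {}"
    and "\<And>z. infdist z (limit_set S p f) \<le> infdist z (limit_set S p h) + d"
  shows "rho S p f \<le> rho S p h + 2 * d"
proof -
  have "(SUP z\<in>S. infdist z (limit_set S p f)) \<le> (SUP z\<in>S. infdist z (limit_set S p h)) + d"
  proof (rule cSUP_least)
    fix z assume "z \<in> S"
    then have "infdist z (limit_set S p h) \<le> (SUP z\<in>S. infdist z (limit_set S p h))"
      using assms by (intro cSUP_upper bdd_above_infdist limit_set_subset)
    then show "infdist z (limit_set S p f) \<le> (SUP z\<in>S. infdist z (limit_set S p h)) + d"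
      using assms(4) [of z] by linarith
  qed (use assms in auto)
  then show ?thesis by (simp add: rho_def)
qed

lemma rho_pos:
  assumes "open S" "bounded S" "S \<noteq> {}" "\<And>i. i \<in> {1..p} \<Longrightarrow> f i ` S \<Subset> S" "limit_set S p f \<noteq> {}"
  shows "rho S p f > 0"
proof -
  define C where "C = (\<Union>i\<in>{1..p}. closure (f i ` S))"
  have C: "compact C" "C \<subseteq> S"
    using assms unfolding C_def rel_compact_in_def
    by (auto simp del: atLeastAtMost_iff)
  have "C \<noteq> S"
    using C assms compact_imp_closed clopen not_bounded_UNIV by metis
  then obtain z where z: "z \<in> S" "z \<notin> C" using C by blast
  have "level_set S p f 1 \<subseteq> C"
  proof
    fix x assume "x \<in> level_set S p f 1"
    then obtain i where "i \<in> {1..p}" "x \<in> f i ` S" by auto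
    then show "x \<in> C"
      using closure_subset [of "f i ` S"] unfolding C_def by blast
  qed
  then have KC: "limit_set S p f \<subseteq> C"
    unfolding limit_set_def by blast
  have "0 < infdist z C"
    using z C KC assms by (intro infdist_pos_not_in_closed compact_imp_closed) auto
  also have "\<dots> \<le> infdist z (limit_set S p f)"
    using KC assms by (intro infdist_mono)
  also have "\<dots> \<le> (SUP z\<in>S. infdist z (limit_set S p f))"
    using z assms by (intro cSUP_upper bdd_above_infdist limit_set_subset)
  finally show ?thesis by (simp add: rho_def)
qed

section \<open>Distorsion\<close>

lemma abs_ln_diff_le:
  fixes a b :: complex
  assumes "0 < m" "m \<le> cmod a" "m \<le> cmod b"
  shows "\<bar>ln (cmod a) - ln (cmod b)\<bar> \<le> cmod (a - b) / m"
proof -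
  have *: "ln (cmod x) - ln (cmod y) \<le> cmod (x - y) / m" if "m \<le> cmod x" "m \<le> cmod y" for x y :: complex
  proof -
    have "ln (cmod x) - ln (cmod y) \<le> (cmod x - cmod y) / cmod y"
      using that assms by (intro ln_diff_le) auto
    also have "\<dots> \<le> cmod (x - y) / m"
      using that assms norm_triangle_ineq2 [of x y] by (intro frac_le) auto
    finally show ?thesis .
  qed
  show ?thesis
    using * [of a b] * [of b a] assms by (simp add: abs_le_iff norm_minus_commute)
qed

lemma lipschitz_on_ln_deriv:
  assumes "open A" "f holomorphic_on A" "Q \<subseteq> A" "convex Q" "0 < m" "0 \<le> M"
    and "\<And>z. z \<in> Q \<Longrightarrow> m \<le> cmod (deriv f z)" "\<And>z. z \<in> Q \<Longrightarrow> cmod (deriv (deriv f) z) \<le> M"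
  shows "(M / m)-lipschitz_on Q (\<lambda>z. ln (cmod (deriv f z)))"
proof (rule lipschitz_onI)
  fix x y assume xy: "x \<in> Q" "y \<in> Q"
  have "(deriv f has_field_derivative deriv (deriv f) z) (at z within Q)" if "z \<in> Q" for z
    using that assms by (meson DERIV_subset subsetD holomorphic_deriv holomorphic_derivI subset_UNIV)
  then have "cmod (deriv f x - deriv f y) \<le> M * cmod (x - y)"
    using xy assms by (intro field_differentiable_bound [of Q]) auto
  then show "dist (ln (cmod (deriv f x))) (ln (cmod (deriv f y))) \<le> M / m * dist x y"
    using abs_ln_diff_le [of m "deriv f x" "deriv f y"] xy assms
    by (simp add: dist_norm) (smt (verit) divide_right_mono)
qed (use assms in auto)

lemma geometric_partial_sum_le:
  fixes q :: real
  assumes "0 \<le> q" "q < 1"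
  shows "(\<Sum>j<n. q ^ j) \<le> 1 / (1 - q)"
  using assms sum_le_suminf [of "\<lambda>j. q ^ j" "{..<n}"] suminf_geometric [of q] by (simp add: summable_geometric)

text \<open>The distorsion of a family of maps that are already defined on a neighbourhood of \<open>Q\<close>.\<close>
definition total_distorsion :: "complex set \<Rightarrow> 'i set \<Rightarrow> ('i \<Rightarrow> complex \<Rightarrow> complex) \<Rightarrow> real" where
  "total_distorsion Q J G =
     (SUP I\<in>lists J. SUP (z, z')\<in>Q \<times> Q. cmod (deriv (fold G I) z / deriv (fold G I) z'))"

text \<open>
  A family of holomorphic maps of \<open>A\<close> into itself, with nonvanishing derivatives, that contract the
  invariant bounded set \<open>Q\<close> by \<open>c\<close> and for which the logarithm of the modulus of the derivative is
  \<open>L\<close>-Lipschitz on \<open>Q\<close>. The constants are parameters, so that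
  several families can be compared with the same \<open>c\<close> and \<open>L\<close>. Below, \<open>A\<close> is the disk \<open>S'\<close> and \<open>Q\<close>
  the closed square.
\<close>
locale conformal_contractions =
  fixes A Q :: "complex set" and J :: "'i set" and G :: "'i \<Rightarrow> complex \<Rightarrow> complex" and c L :: real
  assumes opn: "open A" and QA: "Q \<subseteq> A" and bdd: "bounded Q" and ne: "Q \<noteq> {}"
    and hol: "i \<in> J \<Longrightarrow> G i holomorphic_on A"
    and mapsA: "i \<in> J \<Longrightarrow> G i ` A \<subseteq> A"
    and mapsQ: "i \<in> J \<Longrightarrow> G i ` Q \<subseteq> Q"
    and deriv_nz: "i \<in> J \<Longrightarrow> z \<in> A \<Longrightarrow> deriv (G i) z \<noteq> 0"
    and c: "0 \<le> c" "c < 1"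
    and lip: "i \<in> J \<Longrightarrow> c-lipschitz_on Q (G i)"
    and liplog: "i \<in> J \<Longrightarrow> L-lipschitz_on Q (\<lambda>z. ln (cmod (deriv (G i) z)))"
    and L: "0 \<le> L"
begin

lemma fold_Q: "I \<in> lists J \<Longrightarrow> z \<in> Q \<Longrightarrow> fold G I z \<in> Q"
proof (induction I arbitrary: z)
  case (Cons i I)
  then have "G i z \<in> Q" using mapsQ [of i] by auto
  with Cons show ?case by simp
qed auto

lemma fold_A: "I \<in> lists J \<Longrightarrow> z \<in> A \<Longrightarrow> fold G I z \<in> A"
proof (induction I arbitrary: z)
  case (Cons i I)
  then have "G i z \<in> A" using mapsA [of i] by auto
  with Cons show ?case by simp
qed auto

lemma fold_holomorphic: "I \<in> lists J \<Longrightarrow> fold G I holomorphic_on A"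
proof (induction I)
  case Nil
  then show ?case by (simp add: id_def holomorphic_on_ident)
next
  case (Cons i I)
  then show ?case
    using holomorphic_on_compose_gen [OF hol, of i "fold G I" A] mapsA [of i] by (auto simp: o_def)
qed

lemma deriv_fold_snoc:
  assumes "I \<in> lists J" "i \<in> J" "z \<in> A"
  shows "deriv (fold G (I @ [i])) z = deriv (G i) (fold G I z) * deriv (fold G I) z"
proof -
  have "deriv (G i \<circ> fold G I) z = deriv (G i) (fold G I z) * deriv (fold G I) z"
    using assms hol fold_holomorphic fold_A opn
    by (intro deriv_chain) (auto intro!: holomorphic_on_imp_differentiable_at [of _ A])
  then show ?thesis by (simp add: o_def)
qed

lemma deriv_fold_nonzero: "I \<in> lists J \<Longrightarrow> z \<in> A \<Longrightarrow> deriv (fold G I) z \<noteq> 0"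
proof (induction I rule: rev_induct)
  case Nil
  then show ?case by (simp add: id_def)
next
  case (snoc i I)
  then have I: "I \<in> lists J" "i \<in> J" by auto
  show ?case
    unfolding deriv_fold_snoc [OF I snoc.prems(2)]
    using deriv_nz [OF I(2) fold_A [OF I(1) snoc.prems(2)]] snoc.IH [OF I(1) snoc.prems(2)] by simp
qed

lemma ln_deriv_fold_snoc:
  assumes "I \<in> lists J" "i \<in> J" "z \<in> A"
  shows "ln (cmod (deriv (fold G (I @ [i])) z)) =
    ln (cmod (deriv (fold G I) z)) + ln (cmod (deriv (G i) (fold G I z)))"
  using assms deriv_fold_nonzero [of I z] deriv_nz [of i "fold G I z"] fold_A [of I z]
  unfolding deriv_fold_snoc [OF assms] norm_mult
  by (subst ln_mult) auto

lemma dist_fold_le: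
  "I \<in> lists J \<Longrightarrow> z \<in> Q \<Longrightarrow> w \<in> Q \<Longrightarrow> dist (fold G I z) (fold G I w) \<le> c ^ length I * diameter Q"
proof (induction I rule: rev_induct)
  case Nil
  then show ?case using bdd diameter_bounded_bound by auto
next
  case (snoc i I)
  then have I: "I \<in> lists J" "i \<in> J" by auto
  have "dist (G i (fold G I z)) (G i (fold G I w)) \<le> c * dist (fold G I z) (fold G I w)"
    using lipschitz_onD [OF lip [OF I(2)]] fold_Q I snoc by blast
  also have "\<dots> \<le> c * (c ^ length I * diameter Q)"
    using snoc I c by (intro mult_left_mono) auto
  finally show ?case by simp
qed

text \<open>The logarithm of the distorsion ratio of the word \<open>I\<close> at the points \<open>z\<close> and \<open>w\<close>. It is additive
  along the orbits of \<open>z\<close> and \<open>w\<close>, see \<open>log_distorsion_snoc\<close>.\<close>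
definition log_distorsion where
  "log_distorsion I z w = ln (cmod (deriv (fold G I) z)) - ln (cmod (deriv (fold G I) w))"

lemma log_distorsion_snoc:
  assumes "I \<in> lists J" "i \<in> J" "z \<in> Q" "w \<in> Q"
  shows "log_distorsion (I @ [i]) z w = log_distorsion I z w +
     (ln (cmod (deriv (G i) (fold G I z))) - ln (cmod (deriv (G i) (fold G I w))))"
  using assms ln_deriv_fold_snoc [of I i] QA
  by (simp add: log_distorsion_def subset_iff del: fold_append)

lemma log_distorsion_step:
  assumes "I \<in> lists J" "i \<in> J" "z \<in> Q" "w \<in> Q"
  shows "\<bar>ln (cmod (deriv (G i) (fold G I z))) - ln (cmod (deriv (G i) (fold G I w)))\<bar>
     \<le> L * diameter Q * c ^ length I"
proof -
  have "dist (ln (cmod (deriv (G i) (fold G I z)))) (ln (cmod (deriv (G i) (fold G I w))))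
      \<le> L * dist (fold G I z) (fold G I w)"
    using lipschitz_onD [OF liplog [OF assms(2)]] fold_Q assms by blast
  also have "\<dots> \<le> L * (c ^ length I * diameter Q)"
    using dist_fold_le assms L by (intro mult_left_mono)
  finally show ?thesis by (simp add: dist_real_def mult_ac)
qed

lemma log_distorsion_bounded:
  assumes "I \<in> lists J" "z \<in> Q" "w \<in> Q"
  shows "\<bar>log_distorsion I z w\<bar> \<le> L * diameter Q / (1 - c)"
proof -
  have "\<bar>log_distorsion I z w\<bar> \<le> L * diameter Q * (\<Sum>j<length I. c ^ j)"
    using assms(1)
  proof (induction I rule: rev_induct)
    case Nil
    then show ?case by (simp add: log_distorsion_def id_def)
  next
    case (snoc i I)
    then have I: "I \<in> lists J" "i \<in> J" by auto
    have "\<bar>log_distorsion (I @ [i]) z w\<bar> \<le> \<bar>log_distorsion I z w\<bar> + L * diameter Q * c ^ length I"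
      using log_distorsion_step [OF I assms(2,3)] log_distorsion_snoc [OF I assms(2,3)] by linarith
    then show ?case using snoc.IH [OF I(1)] by (simp add: algebra_simps)
  qed
  also have "\<dots> \<le> L * diameter Q * (1 / (1 - c))"
    using L c bdd by (intro mult_left_mono geometric_partial_sum_le) (auto simp: diameter_ge_0)
  finally show ?thesis by simp
qed

lemma ratio_eq_exp:
  assumes "I \<in> lists J" "z \<in> Q" "w \<in> Q"
  shows "cmod (deriv (fold G I) z / deriv (fold G I) w) = exp (log_distorsion I z w)"
  using assms deriv_fold_nonzero QA
  by (auto simp: log_distorsion_def exp_diff norm_divide subset_iff)

lemma ratio_le_total_distorsion:
  assumes "I \<in> lists J" "z \<in> Q" "w \<in> Q"
  shows "cmod (deriv (fold G I) z / deriv (fold G I) w) \<le> total_distorsion Q J G"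
proof -
  let ?B = "exp (L * diameter Q / (1 - c))"
  have B: "cmod (deriv (fold G I) z / deriv (fold G I) w) \<le> ?B"
    if "I \<in> lists J" "z \<in> Q" "w \<in> Q" for I z w
    using log_distorsion_bounded [OF that] by (simp add: ratio_eq_exp [OF that])
  let ?R = "\<lambda>I (z, z'). cmod (deriv (fold G I) z / deriv (fold G I) z')"
  have R: "?R I x \<le> ?B" if "I \<in> lists J" "x \<in> Q \<times> Q" for I x
    using B [OF that(1), of "fst x" "snd x"] that(2) by (simp add: case_prod_beta mem_Times_iff)
  have "bdd_above (?R I ` (Q \<times> Q))"
    by (rule bdd_aboveI2 [OF R [OF assms(1)]])
  then have "?R I (z, w) \<le> (SUP x\<in>Q \<times> Q. ?R I x)"
    by (intro cSUP_upper) (use assms in auto)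
  also have "\<dots> \<le> total_distorsion Q J G"
    unfolding total_distorsion_def
  proof (rule cSUP_upper)
    have "(SUP x\<in>Q \<times> Q. ?R I x) \<le> ?B" if "I \<in> lists J" for I
      by (rule cSUP_least) (use ne R [OF that] in auto)
    then show "bdd_above ((\<lambda>I. SUP x\<in>Q \<times> Q. ?R I x) ` lists J)"
      by (rule bdd_aboveI2)
  qed fact
  finally show ?thesis by simp
qed

lemma total_distorsion_ge_1: "1 \<le> total_distorsion Q J G"
proof -
  obtain z where "z \<in> Q" using ne by blast
  then show ?thesis
    using ratio_le_total_distorsion [of "[]" z z] by (simp add: id_def)
qed

end

lemma conformal_contractions_fold_perturb:
  assumes "conformal_contractions A Q J G c L" "conformal_contractions A Q J H c L"
    and e: "0 \<le> e" "\<And>i z. i \<in> J \<Longrightarrow> z \<in> Q \<Longrightarrow> dist (G i z) (H i z) \<le> e"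
    and "z \<in> Q" "I \<in> lists J"
  shows "dist (fold G I z) (fold H I z) \<le> e / (1 - c)"
  using \<open>I \<in> lists J\<close>
proof (induction I rule: rev_induct)
  interpret G: conformal_contractions A Q J G c L by fact
  case Nil
  then show ?case using e G.c by simp
next
  interpret G: conformal_contractions A Q J G c L by fact
  interpret H: conformal_contractions A Q J H c L by fact
  case (snoc i I)
  then have I: "I \<in> lists J" "i \<in> J" by auto
  let ?x = "fold G I z" and ?y = "fold H I z"
  have Q: "?x \<in> Q" "?y \<in> Q"
    using G.fold_Q H.fold_Q I assms by auto
  have "dist (G i ?x) (H i ?y) \<le> dist (G i ?x) (G i ?y) + dist (G i ?y) (H i ?y)"
    by metric
  also have "\<dots> \<le> c * dist ?x ?y + e"
    using lipschitz_onD [OF G.lip [OF I(2)] Q] e(2) [OF I(2) Q(2)] by linarith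
  also have "\<dots> \<le> c * (e / (1 - c)) + e"
    using snoc.IH [OF I(1)] G.c by (intro add_right_mono mult_left_mono) auto
  also have "\<dots> = e / (1 - c)"
    using G.c by (simp add: field_simps)
  finally show ?case by simp
qed

text \<open>The bound does not depend on the word \<open>I\<close> and tends to \<open>0\<close> with \<open>e\<close>.\<close>
lemma log_distorsion_perturb:
  assumes G': "conformal_contractions A Q J G c L" and H': "conformal_contractions A Q J H c L"
    and e: "0 \<le> e" "\<And>i z. i \<in> J \<Longrightarrow> z \<in> Q \<Longrightarrow> dist (G i z) (H i z) \<le> e"
    and e': "\<And>i z. i \<in> J \<Longrightarrow> z \<in> Q \<Longrightarrow> \<bar>ln (cmod (deriv (G i) z)) - ln (cmod (deriv (H i) z))\<bar> \<le> e"
    and zw: "z \<in> Q" "w \<in> Q" and "I \<in> lists J"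
  shows "\<bar>conformal_contractions.log_distorsion G I z w - conformal_contractions.log_distorsion H I z w\<bar>
    \<le> sqrt (2 * (e + L * (e / (1 - c))) * (2 * L * diameter Q)) / (1 - sqrt c)" 
proof -
  interpret G: conformal_contractions A Q J G c L by fact
  interpret H: conformal_contractions A Q J H c L by fact
  define a where "a = 2 * (e + L * (e / (1 - c)))"
  define b where "b = 2 * L * diameter Q"
  have ab: "0 \<le> a" "0 \<le> b"
    using e G.c G.L G.bdd by (auto simp: a_def b_def diameter_ge_0)
  have a2: "a / 2 = e + L * (e / (1 - c))"
    by (simp add: a_def)
  have step: "\<bar>(ln (cmod (deriv (G i) (fold G I z))) - ln (cmod (deriv (G i) (fold G I w))))
      - (ln (cmod (deriv (H i) (fold H I z))) - ln (cmod (deriv (H i) (fold H I w))))\<bar>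
      \<le> sqrt (a * b) * sqrt c ^ length I" (is "\<bar>?t\<bar> \<le> _")
    if I: "I \<in> lists J" "i \<in> J" for I i
  proof -
    have near: "\<bar>ln (cmod (deriv (G i) (fold G I x))) - ln (cmod (deriv (H i) (fold H I x)))\<bar> \<le> a / 2"
      if x: "x \<in> Q" for x
    proof -
      have Q: "fold G I x \<in> Q" "fold H I x \<in> Q"
        using G.fold_Q H.fold_Q I x by auto
      have "dist (ln (cmod (deriv (G i) (fold G I x)))) (ln (cmod (deriv (G i) (fold H I x))))
          \<le> L * dist (fold G I x) (fold H I x)"
        using lipschitz_onD [OF G.liplog [OF I(2)] Q] .
      also have "\<dots> \<le> L * (e / (1 - c))"
        using conformal_contractions_fold_perturb [OF G' H' e x I(1)] G.L by (intro mult_left_mono)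
      finally show ?thesis
        using e' [OF I(2) Q(2)] unfolding a2 dist_real_def by linarith
    qed
    have "\<bar>?t\<bar> \<le> a"
      using near [OF zw(1)] near [OF zw(2)] by linarith
    moreover have "\<bar>?t\<bar> \<le> b * c ^ length I"
      using G.log_distorsion_step [OF I zw] H.log_distorsion_step [OF I zw] unfolding b_def by linarith
    \<comment> \<open>the geometric mean of the two bounds is both small and summable\<close>
    ultimately have "\<bar>?t\<bar> * \<bar>?t\<bar> \<le> a * (b * c ^ length I)"
      using ab by (intro mult_mono) auto
    then have "\<bar>?t\<bar> \<le> sqrt (a * (b * c ^ length I))"
      by (intro real_le_rsqrt) (simp add: power2_eq_square)
    also have "\<dots> = sqrt (a * b) * sqrt c ^ length I"
      by (simp add: real_sqrt_mult real_sqrt_power)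
    finally show ?thesis .
  qed
  have "\<bar>G.log_distorsion I z w - H.log_distorsion I z w\<bar> \<le> sqrt (a * b) * (\<Sum>j<length I. sqrt c ^ j)"
    using \<open>I \<in> lists J\<close>
  proof (induction I rule: rev_induct)
    case Nil
    then show ?case by (simp add: G.log_distorsion_def H.log_distorsion_def)
  next
    case (snoc i I)
    then have I: "I \<in> lists J" "i \<in> J" by auto
    have "\<bar>G.log_distorsion (I @ [i]) z w - H.log_distorsion (I @ [i]) z w\<bar>
        \<le> \<bar>G.log_distorsion I z w - H.log_distorsion I z w\<bar> + sqrt (a * b) * sqrt c ^ length I"
      using step [OF I] G.log_distorsion_snoc [OF I zw] H.log_distorsion_snoc [OF I zw] by linarith
    then show ?case using snoc.IH [OF I(1)] by (simp add: algebra_simps)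
  qed
  also have "\<dots> \<le> sqrt (a * b) * (1 / (1 - sqrt c))"
    using ab G.c by (intro mult_left_mono geometric_partial_sum_le) auto
  finally show ?thesis by (simp add: a_def b_def)
qed

lemma total_distorsion_perturb:
  assumes G': "conformal_contractions A Q J G c L" and H': "conformal_contractions A Q J H c L"
    and near: "\<And>I z w. I \<in> lists J \<Longrightarrow> z \<in> Q \<Longrightarrow> w \<in> Q \<Longrightarrow>
      conformal_contractions.log_distorsion G I z w \<le> conformal_contractions.log_distorsion H I z w + \<eta>"
  shows "total_distorsion Q J G \<le> exp \<eta> * total_distorsion Q J H"
proof -
  interpret G: conformal_contractions A Q J G c L by fact
  interpret H: conformal_contractions A Q J H c L by fact
  have *: "cmod (deriv (fold G I) z / deriv (fold G I) w) \<le> exp \<eta> * total_distorsion Q J H"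
    if "I \<in> lists J" "z \<in> Q" "w \<in> Q" for I z w
  proof -
    have "cmod (deriv (fold G I) z / deriv (fold G I) w) \<le> exp (H.log_distorsion I z w + \<eta>)"
      using near [OF that] G.ratio_eq_exp [OF that] by simp
    also have "\<dots> = exp \<eta> * cmod (deriv (fold H I) z / deriv (fold H I) w)"
      using H.ratio_eq_exp [OF that] by (simp add: exp_add)
    also have "\<dots> \<le> exp \<eta> * total_distorsion Q J H"
      using H.ratio_le_total_distorsion [OF that] by simp
    finally show ?thesis .
  qed
  show ?thesis
    unfolding total_distorsion_def [of Q J G]
  proof (rule cSUP_least)
    fix I assume "I \<in> lists J"
    show "(SUP (z, z')\<in>Q \<times> Q. cmod (deriv (fold G I) z / deriv (fold G I) z'))
        \<le> exp \<eta> * total_distorsion Q J H"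
      by (rule cSUP_least) (use * [OF \<open>I \<in> lists J\<close>] G.ne in auto)
  qed (use lists.Nil in blast)
qed

lemma tendsto_total_distorsion:
  fixes G :: "nat \<Rightarrow> 'i \<Rightarrow> complex \<Rightarrow> complex"
  assumes "finite J" 
    and G: "\<forall>\<^sub>F n in sequentially. conformal_contractions A Q J (G n) c L"
    and g: "conformal_contractions A Q J g c L"
    and lim: "\<And>i. i \<in> J \<Longrightarrow> uniform_limit Q (\<lambda>n. G n i) (g i) sequentially"
    and limlog: "\<And>i. i \<in> J \<Longrightarrow> uniform_limit Q (\<lambda>n z. ln (cmod (deriv (G n i) z)))
        (\<lambda>z. ln (cmod (deriv (g i) z))) sequentially"
  shows "(\<lambda>n. total_distorsion Q J (G n)) \<longlonglongrightarrow> total_distorsion Q J g"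
proof -
  interpret g: conformal_contractions A Q J g c L by fact
  define \<beta> where "\<beta> e = sqrt (2 * (e + L * (e / (1 - c))) * (2 * L * diameter Q)) / (1 - sqrt c)" for e
  have "(\<lambda>n. ln (total_distorsion Q J (G n))) \<longlonglongrightarrow> ln (total_distorsion Q J g)"
  proof (rule tendstoI)
    fix \<eta> :: real assume \<eta>: "\<eta> > 0"
    have "(\<beta> \<longlongrightarrow> sqrt (2 * (0 + L * (0 / (1 - c))) * (2 * L * diameter Q)) / (1 - sqrt c)) (at_right 0)"
      unfolding \<beta>_def using g.c by (intro tendsto_intros) auto
    then have "\<forall>\<^sub>F e in at_right 0. \<beta> e < \<eta>"
      using \<eta> by (auto intro: order_tendstoD)
    moreover have "\<forall>\<^sub>F e::real in at_right 0. 0 < e"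
      by (rule eventually_at_right_less)
    ultimately have "\<forall>\<^sub>F e in at_right 0. 0 < e \<and> \<beta> e < \<eta>"
      by eventually_elim auto
    then obtain e where e: "e > 0" "\<beta> e < \<eta>"
      by (metis (no_types, lifting) eventually_happens trivial_limit_at_right_real)
    have "\<forall>\<^sub>F n in sequentially. \<forall>i\<in>J. \<forall>z\<in>Q. dist (G n i z) (g i z) < e"
      using \<open>finite J\<close> lim e by (intro eventually_ball_finite) (auto dest: uniform_limitD)
    moreover have "\<forall>\<^sub>F n in sequentially. \<forall>i\<in>J. \<forall>z\<in>Q.
        dist (ln (cmod (deriv (G n i) z))) (ln (cmod (deriv (g i) z))) < e"
      using \<open>finite J\<close> limlog e by (intro eventually_ball_finite) (auto dest: uniform_limitD)
    ultimately show "\<forall>\<^sub>F n in sequentially.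
        dist (ln (total_distorsion Q J (G n))) (ln (total_distorsion Q J g)) < \<eta>"
      using G
    proof eventually_elim
      case (elim n)
      interpret G: conformal_contractions A Q J "G n" c L by fact
      have "\<bar>G.log_distorsion I z w - g.log_distorsion I z w\<bar> \<le> \<beta> e"
        if "I \<in> lists J" "z \<in> Q" "w \<in> Q" for I z w
        unfolding \<beta>_def
        using elim e that
        by (intro log_distorsion_perturb [OF elim(3) g]) (auto simp: dist_real_def less_imp_le)
      then have near: "G.log_distorsion I z w \<le> g.log_distorsion I z w + \<beta> e"
          "g.log_distorsion I z w \<le> G.log_distorsion I z w + \<beta> e"
        if "I \<in> lists J" "z \<in> Q" "w \<in> Q" for I z w
        using that by (simp_all add: abs_le_iff algebra_simps)
      have *: "ln x \<le> ln y + \<beta> e" if "x \<le> exp (\<beta> e) * y" "1 \<le> x" "1 \<le> y" for x y :: real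
      proof -
        have "ln x \<le> ln (exp (\<beta> e) * y)"
          using that by (subst ln_le_cancel_iff) auto
        then show ?thesis
          using that by (simp add: ln_mult)
      qed
      have "ln (total_distorsion Q J (G n)) \<le> ln (total_distorsion Q J g) + \<beta> e"
        by (intro * total_distorsion_perturb [OF elim(3) g] near
            G.total_distorsion_ge_1 g.total_distorsion_ge_1)
      moreover have "ln (total_distorsion Q J g) \<le> ln (total_distorsion Q J (G n)) + \<beta> e"
        by (intro * total_distorsion_perturb [OF g elim(3)] near
            G.total_distorsion_ge_1 g.total_distorsion_ge_1)
      ultimately show ?case
        using e by (simp add: dist_real_def abs_if)
    qed
  qed
  then have "(\<lambda>n. exp (ln (total_distorsion Q J (G n)))) \<longlonglongrightarrow> exp (ln (total_distorsion Q J g))"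
    by (rule tendsto_exp)
  moreover have "exp (ln (total_distorsion Q J g)) = total_distorsion Q J g"
    using g.total_distorsion_ge_1 by simp
  moreover have "\<forall>\<^sub>F n in sequentially. exp (ln (total_distorsion Q J (G n))) = total_distorsion Q J (G n)"
    using G
  proof eventually_elim
    case (elim n)
    then interpret G: conformal_contractions A Q J "G n" c L .
    show ?case using G.total_distorsion_ge_1 by simp
  qed
  ultimately show ?thesis
    using Lim_transform_eventually by fastforce
qed

section \<open>Continuity on the space of iterated function systems\<close>

text \<open>
  The space \<open>T\<close> need not be first countable: it suffices that \<open>F\<close> is sequentially continuous for
  the coarser topology generated by countably many continuous functions.
\<close>
lemma continuous_map_real_if_sequential:
  fixes F :: "'a \<Rightarrow> real" and \<phi> :: "nat \<Rightarrow> 'a \<Rightarrow> 'b::metric_space"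
  assumes cont: "\<And>k. continuous_map T euclidean (\<phi> k)"
    and seq: "\<And>x X. x \<in> topspace T \<Longrightarrow> (\<And>n. X n \<in> topspace T) \<Longrightarrow>
      (\<And>k. (\<lambda>n. \<phi> k (X n)) \<longlonglongrightarrow> \<phi> k x) \<Longrightarrow> (\<lambda>n. F (X n)) \<longlonglongrightarrow> F x"
  shows "continuous_map T euclideanreal F"
  unfolding continuous_map_def
proof (intro conjI allI impI)
  fix U :: "real set" assume "openin euclidean U"
  then have U: "open U" by simp
  show "openin T {x \<in> topspace T. F x \<in> U}"
  proof (subst openin_subopen, intro ballI, rule ccontr)
    fix x assume x: "x \<in> {x \<in> topspace T. F x \<in> U}"
      and none: "\<not> (\<exists>W. openin T W \<and> x \<in> W \<and> W \<subseteq> {x \<in> topspace T. F x \<in> U})"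
    define W where "W n = topspace T \<inter>
        (\<Inter>k\<in>{..n}. {y \<in> topspace T. \<phi> k y \<in> ball (\<phi> k x) (1 / real (Suc n))})" for n
    have "openin T (W n)" for n
    proof -
      have "openin T {y \<in> topspace T. \<phi> k y \<in> ball (\<phi> k x) (1 / real (Suc n))}" for k
        by (rule openin_continuous_map_preimage [OF cont]) (simp add: open_ball)
      then show ?thesis
        unfolding W_def by (intro openin_Int openin_topspace openin_INT2) auto
    qed
    moreover have "x \<in> W n" for n
      using x by (auto simp: W_def)
    ultimately have "\<exists>y\<in>W n. F y \<notin> U" for n
      using none [unfolded not_ex, rule_format, of "W n"] by (auto simp: W_def)
    then obtain X where X: "\<And>n. X n \<in> W n" "\<And>n. F (X n) \<notin> U"
      by metis
    have "(\<lambda>n. \<phi> k (X n)) \<longlonglongrightarrow> \<phi> k x" for k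
    proof (rule metric_tendsto_imp_tendsto [OF LIMSEQ_inverse_real_of_nat])
      show "\<forall>\<^sub>F n in sequentially. dist (\<phi> k (X n)) (\<phi> k x) \<le> dist (inverse (real (Suc n))) 0"
        using eventually_ge_at_top [of k]
      proof eventually_elim
        case (elim n)
        then have "\<phi> k (X n) \<in> ball (\<phi> k x) (1 / real (Suc n))"
          using X(1) [of n] by (auto simp: W_def)
        then show ?case
          by (simp add: dist_commute inverse_eq_divide less_imp_le)
      qed
    qed
    then have "(\<lambda>n. F (X n)) \<longlonglongrightarrow> F x"
      using x X by (intro seq) (auto simp: W_def)
    then have "\<forall>\<^sub>F n in sequentially. F (X n) \<in> U"
      using U x by (auto dest: topological_tendstoD)
    then show False
      using X(2) by simp
  qed
qed auto

lemma topspace_compact_open_topology: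
  "topspace (compact_open_topology X Y) = {f \<in> extensional (topspace X). continuous_map X Y f}"
proof
  show "topspace (compact_open_topology X Y) \<subseteq> {f \<in> extensional (topspace X). continuous_map X Y f}"
    unfolding compact_open_topology_def topology_generated_by_topspace by blast
  have "{f \<in> extensional (topspace X). continuous_map X Y f \<and> f ` {} \<subseteq> {}} \<in>
    {{f \<in> extensional (topspace X). continuous_map X Y f \<and> f ` C \<subseteq> U} | C U. compactin X C \<and> openin Y U}"
    using compactin_empty openin_empty by blast
  then show "{f \<in> extensional (topspace X). continuous_map X Y f} \<subseteq> topspace (compact_open_topology X Y)"
    unfolding compact_open_topology_def topology_generated_by_topspace by (simp add: Sup_upper)
qed

lemma continuous_map_compact_open_eval:
  assumes "z \<in> topspace X"
  shows "continuous_map (compact_open_topology X Y) Y (\<lambda>f. f z)"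
  unfolding continuous_map_def
proof (intro conjI allI impI)
  show "(\<lambda>f. f z) \<in> topspace (compact_open_topology X Y) \<rightarrow> topspace Y"
    using assms by (auto simp: topspace_compact_open_topology continuous_map_def)
  fix U assume U: "openin Y U"
  have "{f \<in> topspace (compact_open_topology X Y). f z \<in> U}
    = {f \<in> extensional (topspace X). continuous_map X Y f \<and> f ` {z} \<subseteq> U}"
    by (rule Collect_cong) (simp add: topspace_compact_open_topology conj_assoc)
  moreover have "openin (compact_open_topology X Y)
    {f \<in> extensional (topspace X). continuous_map X Y f \<and> f ` {z} \<subseteq> U}"
    unfolding compact_open_topology_def
  proof (rule topology_generated_by_Basis)
    have "compactin X {z}" using assms by simp
    then show "{f \<in> extensional (topspace X). continuous_map X Y f \<and> f ` {z} \<subseteq> U} \<in>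
      {{f \<in> extensional (topspace X). continuous_map X Y f \<and> f ` C \<subseteq> U} | C U. compactin X C \<and> openin Y U}"
      using U by blast
  qed
  ultimately show "openin (compact_open_topology X Y) {f \<in> topspace (compact_open_topology X Y). f z \<in> U}"
    by simp
qed

lemma continuous_map_ifs_space_eval:
  assumes "i \<in> {1..p}" "z \<in> S"
  shows "continuous_map (ifs_space S S' p) euclidean (\<lambda>f. f i z)"
proof -
  have "continuous_map (holomorphic_self_maps S) (top_of_set S) (\<lambda>f. f z)"
    unfolding holomorphic_self_maps_def
    using assms by (intro continuous_map_from_subtopology continuous_map_compact_open_eval) simp
  then have "continuous_map (holomorphic_self_maps S) euclidean (\<lambda>f. f z)"
    by (rule continuous_map_into_fulltopology)
  moreover have "continuous_map (ifs_space S S' p) (holomorphic_self_maps S) (\<lambda>f. f i)"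
    unfolding ifs_space_def
    using assms by (intro continuous_map_from_subtopology continuous_map_product_projection)
  ultimately show ?thesis
    using continuous_map_compose [of _ _ "\<lambda>f. f i" _ "\<lambda>f. f z"] by (simp add: o_def)
qed

section \<open>Convergence of the thickness\<close>

lemma centered_square_properties:
  assumes "centered_square S"
  shows "open S" "convex S" "bounded S" "0 \<in> S" "\<And>z. z \<in> S \<Longrightarrow> - z \<in> S"
proof -
  obtain w where w: "w \<noteq> 0" and S: "S = (\<lambda>z. w * z) ` {z. \<bar>Re z\<bar> < 1 \<and> \<bar>Im z\<bar> < 1}"
    using assms by (auto simp: centered_square_def)
  have box: "{z. \<bar>Re z\<bar> < 1 \<and> \<bar>Im z\<bar> < 1} = box (Complex (-1) (-1)) (Complex 1 1)"
    by (auto simp: in_box_complex_iff)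
  have lin: "linear (\<lambda>z. w * z)"
    by (rule bounded_linear.linear [OF bounded_linear_mult_right])
  have "surj (\<lambda>z. w * z)"
    using w by (auto intro!: surjI [where f = "\<lambda>z. z / w"])
  then show "open S"
    unfolding S box by (intro open_surjective_linear_image lin open_box)
  show "convex S"
    unfolding S box by (intro convex_linear_image lin convex_box)
  show "bounded S"
    unfolding S box by (intro bounded_linear_image bounded_linear_mult_right bounded_box)
  show "0 \<in> S"
    unfolding S by (auto intro!: image_eqI [of _ _ 0])
  show "- z \<in> S" if "z \<in> S" for z
  proof -
    obtain v where "z = w * v" "\<bar>Re v\<bar> < 1" "\<bar>Im v\<bar> < 1" using \<open>z \<in> S\<close> S by blast
    then show ?thesis
      unfolding S by (auto intro!: image_eqI [of _ _ "- v"])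
  qed
qed

lemma closure_square_subset_ball:
  assumes "centered_square S" "0 < r" "r < 1" "diameter (ball 0 R :: complex set) > 1 / r * diameter S"
  shows "closure S \<subseteq> ball 0 R"
proof -
  note S = centered_square_properties [OF assms(1)]
  have D: "0 \<le> diameter S" using S by (simp add: diameter_ge_0)
  then have "diameter S \<le> 1 / r * diameter S"
    using assms by (simp add: field_simps mult_left_le_one_le)
  then have less: "diameter S < diameter (ball 0 R :: complex set)"
    using assms by linarith
  then have R: "diameter S < 2 * R"
    using D by (auto split: if_splits)
  have "S \<subseteq> cball 0 (diameter S / 2)"
  proof
    fix z assume z: "z \<in> S"
    \<comment> \<open>\<open>S\<close> is symmetric about \<open>0\<close>\<close>
    have "dist z (- z) \<le> diameter S"
      using S z by (intro diameter_bounded_bound) auto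
    moreover have "dist z (- z) = 2 * cmod z"
      by (metis dist_norm diff_minus_eq_add mult_2 norm_mult norm_numeral)
    ultimately show "z \<in> cball 0 (diameter S / 2)" by simp
  qed
  then have "closure S \<subseteq> cball 0 (diameter S / 2)"
    by (intro closure_minimal) auto
  also have "\<dots> \<subseteq> ball 0 R" using R by auto
  finally show ?thesis .
qed

lemma ifs_extension_extend_ifs:
  assumes "ifs_map S S' (f i)"
  shows "ifs_extension S S' (f i) (extend_ifs S S' f i)"
  using assms someI_ex [of "ifs_extension S S' (f i)"] unfolding extend_ifs_def ifs_map_def by simp

lemma ifs_extensionD:
  assumes "ifs_extension S S' f g"
  shows "g holomorphic_on S'" "inj_on g S'" "g ` S' \<subseteq> S" "\<And>z. z \<in> S \<Longrightarrow> g z = f z"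
    "\<exists>c<1. c-lipschitz_on S' g"
  using assms closure_subset [of "g ` S'"]
  unfolding ifs_extension_def univalent_contraction_def rel_compact_in_def by auto

lemma inner_diam_single:
  assumes "ifs_extension S S' (f i) g" "open S" "bounded S" "0 \<in> S" "open S'" "closure S \<subseteq> S'"
  shows "inner_diam S f [i] = 2 * infdist (g 0) (g ` frontier S)"
proof -
  note g = ifs_extensionD [OF assms(1)]
  have SS': "S \<subseteq> S'" using assms closure_subset by blast
  have img: "f i ` S = g ` S" "f i 0 = g 0" using g assms by auto
  have "open (g ` S)"
    using g SS' assms by (meson holomorphic_on_subset inj_on_subset open_mapping_thm3)
  moreover have "bounded (g ` S)"
    using g(3) SS' assms by (meson bounded_subset image_mono order_trans)
  ultimately have "Sup {diameter (ball (g 0) t) |t. 0 < t \<and> ball (g 0) t \<subseteq> g ` S}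
      = 2 * infdist (g 0) (frontier (g ` S))"
    using assms by (intro Sup_diameter_balls) auto
  also have "frontier (g ` S) = g ` frontier S"
    using g assms by (intro frontier_univalent_image) auto
  finally show ?thesis
    by (simp add: inner_diam_def img)
qed

lemma inner_diam_Nil:
  assumes "open S" "bounded S" "0 \<in> S"
  shows "inner_diam S f [] > 0"
  using Sup_diameter_balls [OF assms] by (simp add: inner_diam_def)

lemma inner_diam_Nil_cong: "inner_diam S f [] = inner_diam S h []"
  by (simp add: inner_diam_def)

lemma lipschitz_on_deriv_perturb:
  fixes g h :: "complex \<Rightarrow> complex"
  assumes "open A" "g holomorphic_on A" "h holomorphic_on A" "Q \<subseteq> A" "convex Q"
    and "c-lipschitz_on Q g" "0 \<le> \<delta>" "\<And>z. z \<in> Q \<Longrightarrow> cmod (deriv h z - deriv g z) \<le> \<delta>"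
  shows "(c + \<delta>)-lipschitz_on Q h"
proof (rule lipschitz_onI)
  fix x y assume xy: "x \<in> Q" "y \<in> Q"
  have "((\<lambda>z. h z - g z) has_field_derivative deriv h z - deriv g z) (at z within Q)" if "z \<in> Q" for z
    using that assms
    by (intro DERIV_diff) (meson DERIV_subset subsetD holomorphic_derivI subset_UNIV)+
  then have "cmod ((h x - g x) - (h y - g y)) \<le> \<delta> * cmod (x - y)"
    using xy assms by (intro field_differentiable_bound [of Q]) auto
  moreover have "dist (g x) (g y) \<le> c * dist x y"
    using assms xy by (meson lipschitz_onD)
  moreover have "cmod (h x - h y) \<le> cmod ((h x - g x) - (h y - g y)) + cmod (g x - g y)"
    by (rule order_trans [OF _ norm_triangle_ineq]) simp
  ultimately show "dist (h x) (h y) \<le> (c + \<delta>) * dist x y"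
    unfolding dist_norm distrib_right by linarith
next
  show "0 \<le> c + \<delta>"
    using lipschitz_on_nonneg [OF \<open>c-lipschitz_on Q g\<close>] \<open>0 \<le> \<delta>\<close> by simp
qed

text \<open>Of the square and the disk only the following is used.\<close>
locale ifs_domain =
  fixes S S' :: "complex set" and p :: nat
  assumes S: "open S" "convex S" "bounded S" "0 \<in> S"
    and S': "open S'" "connected S'" and SS': "closure S \<subseteq> S'" and p: "p \<ge> 1"
begin

text \<open>All IFS's near \<open>f\<close>, in the sense of derivatives on the closed square, share the
  constants of contraction and distorsion.\<close>
lemma conformal_contractions_near:
  fixes f :: "nat \<Rightarrow> complex \<Rightarrow> complex"
  assumes f: "\<And>i. i \<in> {1..p} \<Longrightarrow> ifs_map S S' (f i)"
  defines "g \<equiv> extend_ifs S S' f"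
  shows "\<exists>c L. \<exists>\<delta>>0.
    (\<forall>h. (\<forall>i\<in>{1..p}. ifs_map S S' (h i)) \<and>
         (\<forall>i\<in>{1..p}. \<forall>z\<in>closure S. cmod (deriv (extend_ifs S S' h i) z - deriv (g i) z) \<le> \<delta>) \<longrightarrow>
       conformal_contractions S' (closure S) {1..p} (extend_ifs S S' h) c L) \<and>
    (\<forall>i\<in>{1..p}. \<forall>z\<in>closure S. 2 * \<delta> \<le> cmod (deriv (g i) z))"
proof -
  have ext: "ifs_extension S S' (f i) (g i)" if "i \<in> {1..p}" for i
    unfolding g_def using ifs_extension_extend_ifs f that by blast
  have Q: "compact (closure S)" "convex (closure S)" "closure S \<noteq> {}"
    using S by (auto simp: convex_closure)
  \<comment> \<open>for each of the finitely many maps every constant close enough to \<open>1\<close> works,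
    hence so does one constant for all of them; likewise for the lower bound \<open>m\<close> below\<close>
  have "\<forall>\<^sub>F c in at_left 1. \<forall>i\<in>{1..p}. c-lipschitz_on (closure S) (g i)"
  proof (intro eventually_ball_finite ballI)
    fix i assume "i \<in> {1..p}"
    then obtain c where c: "c < 1" "c-lipschitz_on S' (g i)"
      using ifs_extensionD [OF ext] by blast
    show "\<forall>\<^sub>F c in at_left 1. c-lipschitz_on (closure S) (g i)"
      using eventually_at_left_real [OF c(1)]
    proof eventually_elim
      case (elim c')
      then show ?case
        using c SS' by (auto intro: lipschitz_on_mono)
    qed
  qed auto
  moreover have "\<forall>\<^sub>F c::real in at_left 1. 0 < c \<and> c < 1"
    using eventually_at_left_real [of 0 "1::real"] by (auto elim: eventually_mono)
  ultimately have "\<forall>\<^sub>F c in at_left 1. (\<forall>i\<in>{1..p}. c-lipschitz_on (closure S) (g i)) \<and> 0 < c \<and> c < 1"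
    by (rule eventually_conj)
  from eventually_happens' [OF trivial_limit_at_left_real this]
  obtain c where c: "0 < c" "c < 1" "\<And>i. i \<in> {1..p} \<Longrightarrow> c-lipschitz_on (closure S) (g i)"
    by blast
  have "\<forall>\<^sub>F m in at_right 0. \<forall>i\<in>{1..p}. \<forall>z\<in>closure S. m \<le> cmod (deriv (g i) z)"
  proof (rule eventually_ball_finite [OF _ ballI])
    fix i assume i: "i \<in> {1..p}"
    note gi = ifs_extensionD [OF ext [OF i]]
    have "continuous_on (closure S) (\<lambda>z. cmod (deriv (g i) z))"
      using gi(1) SS' S'
      by (intro continuous_on_norm holomorphic_on_imp_continuous_on holomorphic_on_subset
          [OF holomorphic_deriv])
    then obtain z0 where z0: "z0 \<in> closure S"
        "\<And>z. z \<in> closure S \<Longrightarrow> cmod (deriv (g i) z0) \<le> cmod (deriv (g i) z)"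
      using continuous_attains_inf [OF Q(1,3)] by blast
    have "0 < cmod (deriv (g i) z0)"
      using holomorphic_injective_imp_regular [OF gi(1) S'(1) gi(2)] z0 SS' by auto
    from eventually_at_right_real [OF this]
    show "\<forall>\<^sub>F m in at_right 0. \<forall>z\<in>closure S. m \<le> cmod (deriv (g i) z)"
    proof eventually_elim
      case (elim m)
      then show ?case using z0(2) by force
    qed
  qed auto
  moreover have "\<forall>\<^sub>F m::real in at_right 0. 0 < m"
    by (rule eventually_at_right_less)
  ultimately have "\<forall>\<^sub>F m in at_right 0. (\<forall>i\<in>{1..p}. \<forall>z\<in>closure S. m \<le> cmod (deriv (g i) z)) \<and> 0 < m"
    by (rule eventually_conj)
  from eventually_happens' [OF trivial_limit_at_right_real this]
  obtain m where m: "0 < m" "\<And>i z. i \<in> {1..p} \<Longrightarrow> z \<in> closure S \<Longrightarrow> m \<le> cmod (deriv (g i) z)"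
    by blast
  obtain d K where d: "d > 0" "K \<subseteq> S'" "\<And>z. z \<in> closure S \<Longrightarrow> cball z d \<subseteq> K"
    using compact_neighbourhood_in_open [OF Q(1) S'(1) SS'] by metis
  obtain B where B: "B > 0" "\<And>z. z \<in> S \<Longrightarrow> cmod z \<le> B"
    using S by (meson bounded_pos)
  \<comment> \<open>the first entry keeps the derivatives above \<open>m / 2\<close>, the second the contraction below \<open>(1 + c) / 2\<close>\<close>
  define \<delta> where "\<delta> = min (m / 2) ((1 - c) / 2)"
  \<comment> \<open>Cauchy's bound on second derivatives of maps from \<open>S'\<close> into \<open>S\<close>\<close>
  define M where "M = 2 * B / d\<^sup>2"
  have conf: "conformal_contractions S' (closure S) {1..p} (extend_ifs S S' h) ((1 + c) / 2) (M / (m / 2))"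
    if h: "\<And>i. i \<in> {1..p} \<Longrightarrow> ifs_map S S' (h i)"
      and near: "\<And>i z. i \<in> {1..p} \<Longrightarrow> z \<in> closure S \<Longrightarrow>
         cmod (deriv (extend_ifs S S' h i) z - deriv (g i) z) \<le> \<delta>"
    for h
  proof -
    let ?h = "extend_ifs S S' h"
    show "conformal_contractions S' (closure S) {1..p} ?h ((1 + c) / 2) (M / (m / 2))"
    proof
      fix i assume i: "i \<in> {1..p}"
      note hi = ifs_extensionD [OF ifs_extension_extend_ifs [of S S' h i, OF h [OF i]]]
      note gi = ifs_extensionD [OF ext [OF i]]
      show hol: "?h i holomorphic_on S'" by (fact hi(1))
      show "?h i ` S' \<subseteq> S'" "?h i ` closure S \<subseteq> closure S"
        using hi(3) SS' closure_subset [of S] by blast+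
      show "deriv (?h i) z \<noteq> 0" if "z \<in> S'" for z
        using holomorphic_injective_imp_regular [OF hi(1) S'(1) hi(2) that] .
      have "(c + (1 - c) / 2)-lipschitz_on (closure S) (?h i)"
      proof (rule lipschitz_on_deriv_perturb [OF S'(1) gi(1) hi(1) SS' Q(2) c(3) [OF i]])
        show "cmod (deriv (?h i) z - deriv (g i) z) \<le> (1 - c) / 2" if "z \<in> closure S" for z
          using near [OF i that] by (simp add: \<delta>_def)
      qed (use c in auto)
      moreover have "c + (1 - c) / 2 = (1 + c) / 2" by (simp add: field_simps)
      ultimately show "((1 + c) / 2)-lipschitz_on (closure S) (?h i)" by simp
      show "(M / (m / 2))-lipschitz_on (closure S) (\<lambda>z. ln (cmod (deriv (?h i) z)))"
      proof (rule lipschitz_on_ln_deriv [OF S'(1) hi(1) SS' Q(2)])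
        fix z assume z: "z \<in> closure S"
        have "cmod (deriv (g i) z) \<le> cmod (deriv (?h i) z - deriv (g i) z) + cmod (deriv (?h i) z)"
          by (metis norm_minus_commute norm_triangle_sub add.commute)
        then show "m / 2 \<le> cmod (deriv (?h i) z)"
          using m(2) [OF i z] near [OF i z] unfolding \<delta>_def by linarith
        show "cmod (deriv (deriv (?h i)) z) \<le> M"
          unfolding M_def
        proof (rule bounded_second_derivative [OF S'(1) hi(1)])
          show "cmod (?h i w) \<le> B" if "w \<in> S'" for w
            using B(2) hi(3) that by blast
          show "cball z d \<subseteq> S'" using d z by blast
        qed (use d in auto)
      qed (use m B d in \<open>auto simp: M_def\<close>)
    qed (use S S' SS' c m B d Q in \<open>auto simp: M_def\<close>)
  qed
  have pos: "\<delta> > 0"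
    using m c by (simp add: \<delta>_def)
  have lower: "2 * \<delta> \<le> cmod (deriv (g i) z)" if "i \<in> {1..p}" "z \<in> closure S" for i z
  proof -
    have "2 * \<delta> \<le> m" unfolding \<delta>_def by linarith
    then show ?thesis using m(2) [OF that] by linarith
  qed
  show ?thesis
  proof (intro exI conjI allI impI ballI)
    show "\<delta> > 0" by (fact pos)
    show "2 * \<delta> \<le> cmod (deriv (g i) z)" if "i \<in> {1..p}" "z \<in> closure S" for i z
      by (fact lower [OF that])
    show "conformal_contractions S' (closure S) {1..p} (extend_ifs S S' h) ((1 + c) / 2) (M / (m / 2))"
      if "(\<forall>i\<in>{1..p}. ifs_map S S' (h i)) \<and>
        (\<forall>i\<in>{1..p}. \<forall>z\<in>closure S. cmod (deriv (extend_ifs S S' h i) z - deriv (g i) z) \<le> \<delta>)" for h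
      using that by (intro conf) auto
  qed
qed

lemma S_subset: "S \<subseteq> S'"
  using SS' closure_subset by blast

lemma frontier_nonempty: "frontier S \<noteq> {}"
  using S frontier_not_empty not_bounded_UNIV by blast

lemma lipschitz_on_S:
  assumes "ifs_map S S' (f i)" "c-lipschitz_on (closure S) (extend_ifs S S' f i)"
  shows "c-lipschitz_on S (f i)"
proof -
  have "c-lipschitz_on S (extend_ifs S S' f i)"
    using assms(2) closure_subset by (rule lipschitz_on_subset)
  then show ?thesis
    by (rule lipschitz_on_transform)
      (simp add: ifs_extensionD(4) [OF ifs_extension_extend_ifs [of S S' f i, OF assms(1)]])
qed

lemma maps_S:
  assumes "ifs_map S S' (f i)"
  shows "f i ` S \<subseteq> S" "f i ` S \<Subset> S"
  using assms closure_subset [of "f i ` S"] by (auto simp: ifs_map_def rel_compact_in_def)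

lemma limit_set_ne:
  assumes "\<And>i. i \<in> {1..p} \<Longrightarrow> ifs_map S S' (f i)"
  shows "limit_set S p f \<noteq> {}"
proof -
  have 1: "1 \<in> {1..p}" using p by simp
  have "univalent_contraction S (f 1)"
    using assms [OF 1] by (simp add: ifs_map_def)
  then obtain c where "c < 1" "c-lipschitz_on S (f 1)"
    by (auto simp: univalent_contraction_def)
  then show ?thesis
    using limit_set_nonempty [of 1 p f S c] 1 maps_S(2) [of f 1, OF assms [OF 1]] S by blast
qed

lemma rho_perturb_ifs:
  assumes f: "\<And>i. i \<in> {1..p} \<Longrightarrow> ifs_map S S' (f i)" and h: "\<And>i. i \<in> {1..p} \<Longrightarrow> ifs_map S S' (h i)"
    and lip: "\<And>i. i \<in> {1..p} \<Longrightarrow> c-lipschitz_on S (f i)" "0 \<le> c" "c < 1"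
    and e: "\<And>i z. i \<in> {1..p} \<Longrightarrow> z \<in> S \<Longrightarrow> dist (f i z) (h i z) \<le> e" "0 \<le> e"
  shows "rho S p f \<le> rho S p h + 2 * (e / (1 - c))"
proof (rule rho_perturb)
  have fS: "f i ` S \<subseteq> S" and hS: "h i ` S \<subseteq> S" if "i \<in> {1..p}" for i
    using maps_S(1) [of f i, OF f [OF that]] maps_S(1) [of h i, OF h [OF that]] by simp_all
  show "infdist z (limit_set S p f) \<le> infdist z (limit_set S p h) + e / (1 - c)" for z
  proof (rule infdist_limit_set_perturb [of p f S c h "e / (1 - c)" z])
    show "\<exists>y\<in>level_set S p f n. dist x y \<le> e / (1 - c)" if "x \<in> level_set S p h n" for n x
      by (rule level_set_perturb [OF fS hS lip e that])
    show "limit_set S p f \<noteq> {}" by (rule limit_set_ne [OF f])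
    show "limit_set S p h \<noteq> {}" by (rule limit_set_ne [OF h])
  qed (use S fS lip in auto)
  show "limit_set S p h \<noteq> {}" by (rule limit_set_ne [OF h])
qed (use S in auto)

text \<open>Convergence of the maps at the points of any set \<open>Z\<close> that accumulates in \<open>S\<close> is enough.\<close>
lemma tendsto_thickness:
  fixes f :: "nat \<Rightarrow> complex \<Rightarrow> complex" and F :: "nat \<Rightarrow> nat \<Rightarrow> complex \<Rightarrow> complex"
  assumes f: "\<And>i. i \<in> {1..p} \<Longrightarrow> ifs_map S S' (f i)"
    and F: "\<And>n i. i \<in> {1..p} \<Longrightarrow> ifs_map S S' (F n i)"
    and Z: "Z \<subseteq> S" "\<xi> \<in> S" "\<xi> islimpt Z"
    and lim: "\<And>i z. i \<in> {1..p} \<Longrightarrow> z \<in> Z \<Longrightarrow> (\<lambda>n. F n i z) \<longlonglongrightarrow> f i z"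
  shows "(\<lambda>n. thickness S S' p (F n)) \<longlonglongrightarrow> thickness S S' p f"
proof -
  define g where "g = extend_ifs S S' f"
  define G where "G n = extend_ifs S S' (F n)" for n
  have ext: "ifs_extension S S' (f i) (g i)" if "i \<in> {1..p}" for i
    unfolding g_def by (rule ifs_extension_extend_ifs [of S S' f i, OF f [OF that]])
  have extF: "ifs_extension S S' (F n i) (G n i)" if "i \<in> {1..p}" for n i
    unfolding G_def by (rule ifs_extension_extend_ifs [of S S' "F n" i, OF F [OF that]])
  obtain B where B: "\<And>z. z \<in> S \<Longrightarrow> cmod z \<le> B"
    using S by (meson bounded_pos)
  have unif: "uniform_limit K (\<lambda>n. G n i) (g i) sequentially"
    if i: "i \<in> {1..p}" and K: "compact K" "K \<subseteq> S'" for i K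
  proof (rule vitali_uniform_limit [OF S' _ _ _ _ _ _ _ K])
    fix n
    note Gi = ifs_extensionD [OF extF [OF i, of n]]
    show "G n i holomorphic_on S'" by (fact Gi(1))
    show "cmod (G n i z) \<le> B" if "z \<in> S'" for z
      using Gi(3) that B by blast
  next
    show "g i holomorphic_on S'" by (fact ifs_extensionD(1) [OF ext [OF i]])
    show "Z \<subseteq> S'" "\<xi> \<in> S'" "\<xi> islimpt Z" using Z S_subset by auto
    show "(\<lambda>n. G n i z) \<longlonglongrightarrow> g i z" if "z \<in> Z" for z
    proof -
      have "z \<in> S" using that Z by blast
      then show ?thesis
        using lim [OF i that] by (simp add: ifs_extensionD(4) [OF extF [OF i]] ifs_extensionD(4) [OF ext [OF i]])
    qed
  qed
  have Q: "compact (closure S)" using S by simp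
  have unif_deriv: "uniform_limit (closure S) (\<lambda>n. deriv (G n i)) (deriv (g i)) sequentially"
    if i: "i \<in> {1..p}" for i
    by (rule uniform_limit_deriv [OF S'(1) ifs_extensionD(1) [OF extF [OF i]]
          ifs_extensionD(1) [OF ext [OF i]] unif [OF i] Q SS'])
  obtain c L \<delta> where \<delta>: "\<delta> > 0"
    and conf: "\<forall>h. (\<forall>i\<in>{1..p}. ifs_map S S' (h i)) \<and>
         (\<forall>i\<in>{1..p}. \<forall>z\<in>closure S. cmod (deriv (extend_ifs S S' h i) z - deriv (g i) z) \<le> \<delta>) \<longrightarrow>
       conformal_contractions S' (closure S) {1..p} (extend_ifs S S' h) c L"
    and "\<forall>i\<in>{1..p}. \<forall>z\<in>closure S. 2 * \<delta> \<le> cmod (deriv (g i) z)"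
    using conformal_contractions_near [of f, OF f] unfolding g_def [symmetric] by metis
  then have lower: "2 * \<delta> \<le> cmod (deriv (g i) z)" if "i \<in> {1..p}" "z \<in> closure S" for i z
    using that by blast
  have near: "\<forall>\<^sub>F n in sequentially. \<forall>z\<in>closure S. cmod (deriv (G n i) z - deriv (g i) z) < e"
    if "i \<in> {1..p}" "e > 0" for i e
    using uniform_limitD [OF unif_deriv [OF that(1)] that(2)] by (simp add: dist_norm)
  have conf_g: "conformal_contractions S' (closure S) {1..p} g c L"
    unfolding g_def using \<delta> f by (intro conf [rule_format]) (auto simp: g_def)
  interpret g: conformal_contractions S' "closure S" "{1..p}" g c L by (fact conf_g)
  have "\<forall>\<^sub>F n in sequentially. \<forall>i\<in>{1..p}. \<forall>z\<in>closure S. cmod (deriv (G n i) z - deriv (g i) z) < \<delta>"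
    by (rule eventually_ball_finite [OF _ ballI]) (auto intro: near \<delta>)
  then have conf_G: "\<forall>\<^sub>F n in sequentially. conformal_contractions S' (closure S) {1..p} (G n) c L"
  proof eventually_elim
    case (elim n)
    show ?case
      using elim F unfolding G_def by (intro conf [rule_format]) (auto intro: less_imp_le)
  qed
  have "uniform_limit (closure S) (\<lambda>n z. ln (cmod (deriv (G n i) z))) (\<lambda>z. ln (cmod (deriv (g i) z))) sequentially"
    if i: "i \<in> {1..p}" for i
    unfolding uniform_limit_iff
  proof (intro allI impI)
    fix e :: real assume e: "e > 0"
    have "\<forall>\<^sub>F n in sequentially. \<forall>z\<in>closure S. cmod (deriv (G n i) z - deriv (g i) z) < min \<delta> (e * \<delta>)"
      using e \<delta> by (intro near i) auto
    then show "\<forall>\<^sub>F n in sequentially. \<forall>z\<in>closure S.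
        dist (ln (cmod (deriv (G n i) z))) (ln (cmod (deriv (g i) z))) < e"
    proof eventually_elim
      case (elim n)
      show ?case
      proof
        fix z assume z: "z \<in> closure S"
        have d: "cmod (deriv (G n i) z - deriv (g i) z) < \<delta>" "cmod (deriv (G n i) z - deriv (g i) z) < e * \<delta>"
          using elim z by auto
        have "cmod (deriv (g i) z) \<le> cmod (deriv (G n i) z - deriv (g i) z) + cmod (deriv (G n i) z)"
          by (metis norm_minus_commute norm_triangle_sub add.commute)
        then have "\<bar>ln (cmod (deriv (G n i) z)) - ln (cmod (deriv (g i) z))\<bar>
            \<le> cmod (deriv (G n i) z - deriv (g i) z) / \<delta>"
          using lower [OF i z] d(1) \<delta> by (intro abs_ln_diff_le) linarith+
        also have "\<dots> < e"
          using d(2) \<delta> by (simp add: field_simps)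
        finally show "dist (ln (cmod (deriv (G n i) z))) (ln (cmod (deriv (g i) z))) < e"
          by (simp add: dist_real_def)
      qed
    qed
  qed
  then have "(\<lambda>n. total_distorsion (closure S) {1..p} (G n)) \<longlonglongrightarrow> total_distorsion (closure S) {1..p} g"
    by (intro tendsto_total_distorsion [OF _ conf_G conf_g] unif Q SS') auto
  then have dist: "(\<lambda>n. distorsion S S' p (F n)) \<longlonglongrightarrow> distorsion S S' p f"
    by (simp add: distorsion_def total_distorsion_def G_def g_def)
  have dist_pos: "distorsion S S' p f > 0"
    using g.total_distorsion_ge_1 by (simp add: distorsion_def total_distorsion_def g_def)
  have rho: "(\<lambda>n. rho S p (F n)) \<longlonglongrightarrow> rho S p f"
  proof (rule tendstoI)
    fix \<eta> :: real assume \<eta>: "\<eta> > 0"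
    define e where "e = \<eta> * (1 - c) / 4"
    have e: "e > 0" "2 * (e / (1 - c)) < \<eta>"
      using \<eta> g.c by (auto simp: e_def field_simps)
    have "\<forall>\<^sub>F n in sequentially. \<forall>i\<in>{1..p}. \<forall>z\<in>closure S. dist (G n i z) (g i z) < e"
    proof (rule eventually_ball_finite [OF _ ballI])
      show "\<forall>\<^sub>F n in sequentially. \<forall>z\<in>closure S. dist (G n i z) (g i z) < e" if "i \<in> {1..p}" for i
        by (rule uniform_limitD [OF unif [OF that Q SS'] e(1)])
    qed simp
    then show "\<forall>\<^sub>F n in sequentially. dist (rho S p (F n)) (rho S p f) < \<eta>"
      using conf_G
    proof eventually_elim
      case (elim n)
      interpret Gn: conformal_contractions S' "closure S" "{1..p}" "G n" c L by (fact elim(2))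
      have d: "dist (F n i z) (f i z) \<le> e" "dist (f i z) (F n i z) \<le> e" if "i \<in> {1..p}" "z \<in> S" for i z
      proof -
        have "dist (G n i z) (g i z) < e"
          using elim(1) that closure_subset by blast
        then show "dist (F n i z) (f i z) \<le> e" "dist (f i z) (F n i z) \<le> e"
          using ifs_extensionD(4) [OF extF [OF that(1)] that(2)] ifs_extensionD(4) [OF ext [OF that(1)] that(2)]
          by (simp_all add: dist_commute)
      qed
      have lipF: "c-lipschitz_on S (F n i)" if "i \<in> {1..p}" for i
        using lipschitz_on_S [of "F n" i c] F [OF that] Gn.lip [OF that] by (simp add: G_def)
      have lipf: "c-lipschitz_on S (f i)" if "i \<in> {1..p}" for i
        using lipschitz_on_S [of f i c] f [OF that] g.lip [OF that] by (simp add: g_def)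
      have "rho S p (F n) \<le> rho S p f + 2 * (e / (1 - c))"
        by (rule rho_perturb_ifs [of "F n" f c e, OF F f lipF g.c d(1)]) (use e in auto)
      moreover have "rho S p f \<le> rho S p (F n) + 2 * (e / (1 - c))"
        by (rule rho_perturb_ifs [of f "F n" c e, OF f F lipf g.c d(2)]) (use e in auto)
      ultimately show ?case
        using e(2) by (simp add: dist_real_def abs_if)
    qed
  qed
  have rho_pos: "rho S p f > 0"
    using S by (intro rho_pos limit_set_ne f maps_S(2)) auto
  define s where "s = inner_diam S f []"
  have s: "inner_diam S (F n) [] = s" "s > 0" for n
    unfolding s_def using S by (auto intro: inner_diam_Nil_cong inner_diam_Nil)
  have "(\<lambda>n. inner_diam S (F n) [i]) \<longlonglongrightarrow> inner_diam S f [i]" if i: "i \<in> {1..p}" for i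
  proof -
    have "(\<lambda>n. infdist (G n i 0) (G n i ` frontier S)) \<longlonglongrightarrow> infdist (g i 0) (g i ` frontier S)"
    proof (rule tendsto_infdist_image [OF unif [OF i Q SS']])
      show "0 \<in> closure S" using S closure_subset by blast
      show "frontier S \<subseteq> closure S" by (simp add: frontier_def)
    qed (rule frontier_nonempty)
    then have "(\<lambda>n. 2 * infdist (G n i 0) (G n i ` frontier S)) \<longlonglongrightarrow> 2 * infdist (g i 0) (g i ` frontier S)"
      by (rule tendsto_mult_left)
    then show ?thesis
      using inner_diam_single [of S S' f i, OF ext [OF i] S(1,3,4) S'(1) SS']
        inner_diam_single [of S S' "F n" i for n, OF extF [OF i] S(1,3,4) S'(1) SS']
      by simp
  qed
  then have lam: "(\<lambda>n. lambda0 S p (F n)) \<longlonglongrightarrow> lambda0 S p f"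
    unfolding lambda0_def s s_def [symmetric] using p s by (intro tendsto_Min_image tendsto_divide) auto
  have sig: "(\<lambda>n. sigma0 S p (F n)) \<longlonglongrightarrow> sigma0 S p f" "sigma0 S p f > 0"
    unfolding sigma0_def s s_def [symmetric] using rho rho_pos s by (auto intro!: tendsto_divide)
  show ?thesis
    unfolding thickness_def lambda_def sigma_def
    using dist_pos sig(2) by (intro tendsto_intros lam dist sig(1)) auto
qed

end

theorem theoremB:
  fixes S S' :: "complex set" and p :: nat and r R :: real
  assumes "centered_square S"
    and "p \<ge> 1"
    and "0 < r" and "r < 1"
    and "S' = ball 0 R"
    and "diameter S' > 1 / r * diameter S"
  shows "continuous_map (ifs_space S S' p) euclideanreal (thickness S S' p)"
proof -
  note S = centered_square_properties [OF assms(1)]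
  have "closure S \<subseteq> ball 0 R"
    using assms by (intro closure_square_subset_ball [of S r]) auto
  then interpret ifs_domain S S' p
    using S assms by unfold_locales auto
  have "0 islimpt S"
    using S by (simp add: interior_limit_point interior_open)
  then obtain \<zeta> where \<zeta>: "\<And>k. \<zeta> k \<in> S - {0}" "\<zeta> \<longlonglongrightarrow> 0"
    by (auto simp: islimpt_sequential)
  then have limpt: "0 islimpt range \<zeta>"
    unfolding islimpt_sequential by (intro exI [of _ \<zeta>]) auto
  \<comment> \<open>the evaluations of all components at all the points \<open>\<zeta> j\<close>, in one enumeration\<close>
  define \<phi> :: "nat \<Rightarrow> (nat \<Rightarrow> complex \<Rightarrow> complex) \<Rightarrow> complex" where
    "\<phi> k f = (case prod_decode k of (i, j) \<Rightarrow> if i \<in> {1..p} then f i (\<zeta> j) else 0)" for k f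
  show ?thesis
  proof (rule continuous_map_real_if_sequential [of _ \<phi>])
    fix k
    obtain i j where ij: "prod_decode k = (i, j)" by fastforce
    show "continuous_map (ifs_space S S' p) euclidean (\<phi> k)"
    proof (cases "i \<in> {1..p}")
      case True
      then have "\<phi> k = (\<lambda>f. f i (\<zeta> j))" by (simp add: \<phi>_def ij fun_eq_iff)
      then show ?thesis
        using continuous_map_ifs_space_eval [OF True, of "\<zeta> j" S S'] \<zeta>(1) by auto
    next
      case False
      then have "\<phi> k = (\<lambda>f. 0)" by (auto simp: \<phi>_def ij fun_eq_iff)
      then show ?thesis by simp
    qed
  next
    fix f :: "nat \<Rightarrow> complex \<Rightarrow> complex" and F :: "nat \<Rightarrow> nat \<Rightarrow> complex \<Rightarrow> complex"
    assume f: "f \<in> topspace (ifs_space S S' p)" and F: "\<And>n. F n \<in> topspace (ifs_space S S' p)"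
      and lim: "\<And>k. (\<lambda>n. \<phi> k (F n)) \<longlonglongrightarrow> \<phi> k f"
    have ifs: "ifs_map S S' (h i)" if "h \<in> topspace (ifs_space S S' p)" "i \<in> {1..p}" for h i
      using that unfolding ifs_space_def topspace_subtopology by blast
    show "(\<lambda>n. thickness S S' p (F n)) \<longlonglongrightarrow> thickness S S' p f"
    proof (rule tendsto_thickness [where Z = "range \<zeta>" and \<xi> = 0, OF ifs [OF f] ifs [OF F]])
      show "(\<lambda>n. F n i z) \<longlonglongrightarrow> f i z" if "i \<in> {1..p}" "z \<in> range \<zeta>" for i z
      proof -
        obtain j where "z = \<zeta> j" using \<open>z \<in> range \<zeta>\<close> by blast
        then show ?thesis
          using lim [of "prod_encode (i, j)"] that by (simp add: \<phi>_def)
      qed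
    qed (use \<zeta> S limpt in auto)
  qed
qed

end
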